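(* Let $(A_0,A_1)$ be a compatible couple of quasi-normed spaces, let $0<p\le\infty$ and $b_0,b_1\in SV_{1,p}$. For $t>0$ and $f\in A_0+A_1$ put $$\eta(t)=\frac{\|u^{-1/p}b_0(u)\|_{p,(0,t)}}{\|u^{-1/p}b_1(u)\|_{p,(0,t)}},$$ $$I_1(t,f)=\|u^{-1-1/p}b_0(u)K(u,f;A_0,A_1)\|_{p,(0,t)},\qquad J_1(t,f)=\|u^{-1-1/p}b_1(u)K(u,f;A_0,A_1)\|_{p,(t,\infty)}.$$ Assume that $\eta$ is increasing. In the case $p<\infty$, assume additionally that the couple $(A_0,A_1)$ is $K$-surjective. Then, for all $f\in A_0+A_1$ and all $t>0$, $$K(\eta(t),f;\bar A_{1,p;b_0},\bar A_{1,p;b_1})\approx I_1(t,f)+\eta(t)\,J_1(t,f).$$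
   Context: Notation: $\|\cdot\|_{q,(a,b)}$ is the $L^q$-quasi-norm on $(a,b)$ with respect to Lebesgue measure ($1/q=0$ if $q=\infty$). $A\lesssim B$ means $A\le cB$ with a positive constant $c$ independent of the appropriate parameters (here independent of $f$ and $t$); $A\approx B$ means $A\lesssim B$ and $B\lesssim A$. Slowly varying functions: a Lebesgue measurable $b:(0,\infty)\to(0,\infty)$ is slowly varying, $b\in SV$, if for every $\varepsilon>0$ there are positive functions $g_\varepsilon$ (non-decreasing) and $g_{-\varepsilon}$ (non-increasing) on $(0,\infty)$ with $t^{\varepsilon}b(t)\approx g_\varepsilon(t)$ and $t^{-\varepsilon}b(t)\approx g_{-\varepsilon}(t)$ for all $t>0$. For $0<q\le\infty$, $b\in SV_{0,q}$ means $b\in SV$ and $\|u^{-1/q}b(u)\|_{q,(1,\infty)}<\infty$; $b\in SV_{1,q}$ means that $t\mapsto b(1/t)$ belongs to $SV_{0,q}$. Compatible couple: quasi-normed spaces $A_0,A_1$ continuously embedded in the same Hausdorff topological vector space. For $f\in A_0+A_1$, $t>0$, $K(t,f;A_0,A_1)=\inf\{\|f_0\|_{A_0}+t\|f_1\|_{A_1}: f_0\in A_0,\ f_1\in A_1,\ f=f_0+f_1\}$, with the convention $\inf\emptyset=\infty$ when a $K$-functional is taken at an element outside the sum of the couple. For $0<q\le\infty$, $0\le\theta\le1$, $b\in SV$, $\bar A_{\theta,q;b}=(A_0,A_1)_{\theta,q;b}$ is the space of $f\in A_0+A_1$ with $\|f\|_{\bar A_{\theta,q;b}}=\|t^{-\theta-1/q}b(t)K(t,f;A_0,A_1)\|_{q,(0,\infty)}<\infty$.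 A function $\phi:(0,\infty)\to(0,\infty)$ is quasi-concave if both $\phi(t)$ and $t\phi(1/t)$ are non-decreasing. The couple $(A_0,A_1)$ is $K$-surjective if for every quasi-concave $\phi$ there is $f\in A_0+A_1$ with $\phi(t)\approx K(t,f;A_0,A_1)$, $t>0$. *)

theory Defs
  imports "HOL-Analysis.Analysis" "HOL-Probability.Essential_Supremum"
begin

section \<open>Equivalence of nonnegative quantities\<close>

definition lesssim_on :: "'x set \<Rightarrow> ('x \<Rightarrow> ennreal) \<Rightarrow> ('x \<Rightarrow> ennreal) \<Rightarrow> bool" where
  "lesssim_on S F G \<longleftrightarrow> (\<exists>c::real. c > 0 \<and> (\<forall>x\<in>S. F x \<le> ennreal c * G x))"

definition approx_on :: "'x set \<Rightarrow> ('x \<Rightarrow> ennreal) \<Rightarrow> ('x \<Rightarrow> ennreal) \<Rightarrow> bool" where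
  "approx_on S F G \<longleftrightarrow> lesssim_on S F G \<and> lesssim_on S G F"

section \<open>Lebesgue quasi-norms\<close>

text \<open>Powers with a positive real exponent; with \<open>\<infinity>\<close> mapped to itself.\<close>

definition epowr :: "ennreal \<Rightarrow> real \<Rightarrow> ennreal" where
  "epowr x r = (if x = \<infinity> then \<infinity> else ennreal (enn2real x powr r))"

text \<open>The number \<open>1/q\<close> for \<open>0 < q \<le> \<infinity>\<close>; it is \<open>0\<close> for \<open>q = \<infinity>\<close>.\<close>

definition rec_exp :: "ennreal \<Rightarrow> real" where
  "rec_exp q = enn2real (1 / q)"

definition Lq_norm :: "ennreal \<Rightarrow> real set \<Rightarrow> (real \<Rightarrow> ennreal) \<Rightarrow> ennreal" where
  "Lq_norm q S g =
     (if q = \<infinity> then esssup (lebesgue_on S) g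
      else epowr (\<integral>\<^sup>+u. epowr (g u) (enn2real q) \<partial>lebesgue_on S) (1 / enn2real q))"

section \<open>Slowly varying functions\<close>

text \<open>Functions on \<open>(0,\<infinity>)\<close> are functions on \<^typ>\<open>real\<close> whose values outside
  \<open>{0<..}\<close> are irrelevant.\<close>

definition SV :: "(real \<Rightarrow> real) set" where
  "SV = {b. b \<in> borel_measurable (lebesgue_on {0<..}) \<and> (\<forall>t>0. b t > 0) \<and>
     (\<forall>\<epsilon>>0.
        (\<exists>g. (\<forall>t>0. g t > 0) \<and> mono_on {0<..} g \<and>
             approx_on {0<..} (\<lambda>t. ennreal (t powr \<epsilon> * b t)) (\<lambda>t. ennreal (g t))) \<and>
        (\<exists>h. (\<forall>t>0. h t > (0::real)) \<and> antimono_on {0<..} h \<and>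
             approx_on {0<..} (\<lambda>t. ennreal (t powr (-\<epsilon>) * b t)) (\<lambda>t. ennreal (h t))))}"

definition SV0 :: "ennreal \<Rightarrow> (real \<Rightarrow> real) set" where
  "SV0 q = {b \<in> SV. Lq_norm q {1<..} (\<lambda>u. ennreal (u powr (- rec_exp q) * b u)) < \<infinity>}"

definition SV1 :: "ennreal \<Rightarrow> (real \<Rightarrow> real) set" where
  "SV1 q = {b. (\<lambda>t. b (1 / t)) \<in> SV0 q}"

section \<open>Compatible couples of quasi-normed spaces\<close>

text \<open>The members of a couple are identified with linear subspaces of the ambient topological
  vector space. Scalars are real; complex spaces are covered by restriction of scalars, since
  nothing below involves the scalars.\<close>

record 'a qspace =
  carrier :: "'a set"
  qnorm :: "'a \<Rightarrow> real"

definition quasi_normed_space :: "'a::real_vector qspace \<Rightarrow> bool" where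
  "quasi_normed_space A \<longleftrightarrow>
     subspace (carrier A) \<and>
     (\<forall>x\<in>carrier A. qnorm A x \<ge> 0 \<and> (qnorm A x = 0 \<longleftrightarrow> x = 0)) \<and>
     (\<forall>a. \<forall>x\<in>carrier A. qnorm A (a *\<^sub>R x) = \<bar>a\<bar> * qnorm A x) \<and>
     (\<exists>C\<ge>1. \<forall>x\<in>carrier A. \<forall>y\<in>carrier A. qnorm A (x + y) \<le> C * (qnorm A x + qnorm A y))"

definition qtopology :: "'a::real_vector qspace \<Rightarrow> 'a topology" where
  "qtopology A = topology (\<lambda>U. U \<subseteq> carrier A \<and>
     (\<forall>x\<in>U. \<exists>r>0. \<forall>y\<in>carrier A. qnorm A (y - x) < r \<longrightarrow> y \<in> U))"

lemma openin_qtopology: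
  "openin (qtopology A) U \<longleftrightarrow> U \<subseteq> carrier A \<and>
     (\<forall>x\<in>U. \<exists>r>0. \<forall>y\<in>carrier A. qnorm A (y - x) < r \<longrightarrow> y \<in> U)"
proof -
  let ?P = "\<lambda>U. U \<subseteq> carrier A \<and>
     (\<forall>x\<in>U. \<exists>r>0. \<forall>y\<in>carrier A. qnorm A (y - x) < r \<longrightarrow> y \<in> U)"
  have "?P (S \<inter> T)" if S: "?P S" and T: "?P T" for S T
  proof (intro conjI ballI)
    show "S \<inter> T \<subseteq> carrier A" using S by blast
    fix x assume x: "x \<in> S \<inter> T"
    obtain r where r: "r > 0" "\<forall>y\<in>carrier A. qnorm A (y - x) < r \<longrightarrow> y \<in> S"
      using S x by blast
    obtain s where s: "s > 0" "\<forall>y\<in>carrier A. qnorm A (y - x) < s \<longrightarrow> y \<in> T"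
      using T x by blast
    show "\<exists>r>0. \<forall>y\<in>carrier A. qnorm A (y - x) < r \<longrightarrow> y \<in> S \<inter> T"
      using r s by (intro exI[of _ "min r s"]) auto
  qed
  moreover have "?P (\<Union>\<K>)" if "\<forall>K\<in>\<K>. ?P K" for \<K>
    using that by (meson UnionE UnionI Union_least)
  ultimately have "istopology ?P"
    unfolding istopology_def by blast
  then show ?thesis
    by (simp add: qtopology_def)
qed

definition hausdorff_tvs :: "'a::real_vector topology \<Rightarrow> bool" where
  "hausdorff_tvs T \<longleftrightarrow> topspace T = UNIV \<and> Hausdorff_space T \<and>
     continuous_map (prod_topology T T) T (\<lambda>(x, y). x + y) \<and>
     continuous_map (prod_topology euclideanreal T) T (\<lambda>(a, x). a *\<^sub>R x)"

definition compatible_couple :: "'a::real_vector qspace \<Rightarrow> 'a qspace \<Rightarrow> bool" where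
  "compatible_couple A0 A1 \<longleftrightarrow>
     quasi_normed_space A0 \<and> quasi_normed_space A1 \<and>
     (\<exists>T. hausdorff_tvs T \<and> continuous_map (qtopology A0) T (\<lambda>x. x) \<and>
          continuous_map (qtopology A1) T (\<lambda>x. x))"

section \<open>The K-functional and the interpolation spaces\<close>

text \<open>In \<^typ>\<open>ennreal\<close> the infimum of the empty set is \<open>\<infinity>\<close>, so the functional is \<open>\<infinity>\<close> at elements
  outside the sum of the couple.\<close>

definition K_functional :: "ennreal \<Rightarrow> 'a::real_vector \<Rightarrow> 'a qspace \<Rightarrow> 'a qspace \<Rightarrow> ennreal" where
  "K_functional t f A0 A1 =
     (INF (f0, f1) \<in> {(f0, f1). f0 \<in> carrier A0 \<and> f1 \<in> carrier A1 \<and> f = f0 + f1}.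
        ennreal (qnorm A0 f0) + t * ennreal (qnorm A1 f1))"

definition interp_norm ::
  "'a::real_vector qspace \<Rightarrow> 'a qspace \<Rightarrow> real \<Rightarrow> ennreal \<Rightarrow> (real \<Rightarrow> real) \<Rightarrow> 'a \<Rightarrow> ennreal" where
  "interp_norm A0 A1 \<theta> q b f =
     Lq_norm q {0<..}
       (\<lambda>t. ennreal (t powr (- \<theta> - rec_exp q) * b t) * K_functional (ennreal t) f A0 A1)"

text \<open>The real-valued quasi-norm loses nothing: on the carrier \<^const>\<open>interp_norm\<close> is finite.\<close>

definition interp_space ::
  "'a::real_vector qspace \<Rightarrow> 'a qspace \<Rightarrow> real \<Rightarrow> ennreal \<Rightarrow> (real \<Rightarrow> real) \<Rightarrow> 'a qspace" where
  "interp_space A0 A1 \<theta> q b =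
     \<lparr> carrier = {f \<in> carrier A0 + carrier A1. interp_norm A0 A1 \<theta> q b f < \<infinity>},
       qnorm = (\<lambda>f. enn2real (interp_norm A0 A1 \<theta> q b f)) \<rparr>"

definition quasi_concave :: "(real \<Rightarrow> real) \<Rightarrow> bool" where
  "quasi_concave \<phi> \<longleftrightarrow> (\<forall>t>0. \<phi> t > 0) \<and> mono_on {0<..} \<phi> \<and> mono_on {0<..} (\<lambda>t. t * \<phi> (1 / t))"

definition K_surjective :: "'a::real_vector qspace \<Rightarrow> 'a qspace \<Rightarrow> bool" where
  "K_surjective A0 A1 \<longleftrightarrow>
     (\<forall>\<phi>. quasi_concave \<phi> \<longrightarrow>
        (\<exists>f \<in> carrier A0 + carrier A1.
           approx_on {0<..} (\<lambda>t. ennreal (\<phi> t)) (\<lambda>t. K_functional (ennreal t) f A0 A1)))"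

section \<open>The quantities in the Holmstedt-type formula\<close>

text \<open>Both norms in \<open>\<eta>\<close> are positive and finite for \<open>t > 0\<close> when \<open>b0, b1 \<in> SV1 p\<close>.\<close>

definition eta :: "ennreal \<Rightarrow> (real \<Rightarrow> real) \<Rightarrow> (real \<Rightarrow> real) \<Rightarrow> real \<Rightarrow> ennreal" where
  "eta p b0 b1 t =
     Lq_norm p {0<..<t} (\<lambda>u. ennreal (u powr (- rec_exp p) * b0 u)) /
     Lq_norm p {0<..<t} (\<lambda>u. ennreal (u powr (- rec_exp p) * b1 u))"

definition I1 ::
  "'a::real_vector qspace \<Rightarrow> 'a qspace \<Rightarrow> ennreal \<Rightarrow> (real \<Rightarrow> real) \<Rightarrow> real \<Rightarrow> 'a \<Rightarrow> ennreal" where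
  "I1 A0 A1 p b0 t f =
     Lq_norm p {0<..<t}
       (\<lambda>u. ennreal (u powr (- 1 - rec_exp p) * b0 u) * K_functional (ennreal u) f A0 A1)"

definition J1 ::
  "'a::real_vector qspace \<Rightarrow> 'a qspace \<Rightarrow> ennreal \<Rightarrow> (real \<Rightarrow> real) \<Rightarrow> real \<Rightarrow> 'a \<Rightarrow> ennreal" where
  "J1 A0 A1 p b1 t f =
     Lq_norm p {t<..}
       (\<lambda>u. ennreal (u powr (- 1 - rec_exp p) * b1 u) * K_functional (ennreal u) f A0 A1)"

end

theory Submission
  imports Defs
begin

text \<open>
  Write \<open>k(u) = K(u,f;A0,A1)/u\<close>, a non-increasing function that loses at most a factor \<open>2\<close>
  when its argument doubles, write \<open>w\<^sub>i(u) = u\<^sup>-\<^sup>1\<^sup>/\<^sup>p b\<^sub>i(u)\<close>, and let \<open>B\<^sub>i(t)\<close> be the \<open>L\<^sup>p\<close> quasi-norm of \<open>w\<^sub>i\<close> on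
  \<open>(0,t)\<close>. Then \<open>\<eta> = B\<^sub>0/B\<^sub>1\<close>, the norm of \<open>f\<close> in the \<open>i\<close>-th interpolation space is the quasi-norm of
  \<open>k w\<^sub>i\<close> on \<open>(0,\<infinity>)\<close>, and \<open>I\<^sub>1\<close>, \<open>J\<^sub>1\<close> are the quasi-norms of \<open>k w\<^sub>0\<close> on \<open>(0,t)\<close> and of \<open>k w\<^sub>1\<close> on
  \<open>(t,\<infinity>)\<close>. The two inequalities have different sources.

  The estimate of \<open>I\<^sub>1 + \<eta> J\<^sub>1\<close> from above by the K-functional rests on the monotonicity of \<open>\<eta>\<close>.
  By the quasi-triangle inequality it suffices to treat the two summands of a decomposition of
  \<open>f\<close> separately. The nontrivial terms are the part over \<open>(0,t)\<close> of the summand in the second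
  space and the part over \<open>(t,\<infinity>)\<close> of the summand in the first space. Monotonicity of \<open>\<eta>\<close>
  says that \<open>B\<^sub>0(r) \<le> \<eta>(t) B\<^sub>1(r)\<close> for \<open>r \<le> t\<close>, with the reverse inequality for \<open>r \<ge> t\<close>. A comparison
  of two weights over all initial intervals passes to the weights multiplied by a non-increasing
  \<open>k\<close>, because the superlevel sets of \<open>k\<close> are initial intervals (\<open>Lq_norm_Hardy\<close>). This
  moves each term to the weight of the right space.

  The estimate of the K-functional from above uses a decomposition of \<open>f\<close> that is almost optimal
  for \<open>K(t,f;A0,A1)\<close>, as in the classical theorem of Holmstedt. Below \<open>t\<close> the quotient \<open>k\<close> of the
  first summand is controlled by that of \<open>f\<close>, and beyond \<open>t\<close> by the constant \<open>K(t,f)\<close> divided by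
  \<open>u\<close>; for the second summand the roles are exchanged. All error terms have the size
  \<open>K(t,f) B\<^sub>0(t)/t\<close>, because the quasi-norm of \<open>w\<^sub>i(u)/u\<close> on \<open>(t,\<infinity>)\<close> is at most a constant times
  \<open>B\<^sub>i(t)/t\<close>; this is where slow variation enters (\<open>weight_tail_initial\<close>). Finally
  \<open>K(t,f) B\<^sub>0(t)/t \<le> I\<^sub>1(t,f)\<close> since \<open>k\<close> is non-increasing.
\<close>

section \<open>Lebesgue quasi-norms\<close>

lemma epowr_mono: "x \<le> y \<Longrightarrow> 0 < r \<Longrightarrow> epowr x r \<le> epowr y r"
  unfolding epowr_def
  by (auto simp: top_unique intro!: ennreal_leI powr_mono2 enn2real_mono simp: less_top)

lemma epowr_inverse: "0 < r \<Longrightarrow> epowr (epowr x r) (1 / r) = x"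
  unfolding epowr_def by (auto simp: powr_powr less_top)

lemma epowr_inverse': "0 < r \<Longrightarrow> epowr (epowr x (1 / r)) r = x"
  using epowr_inverse[of "1 / r" x] by simp

lemma epowr_mult: "0 < r \<Longrightarrow> epowr (x * y) r = epowr x r * epowr y r"
proof -
  assume r: "0 < r"
  have top: "epowr (\<infinity> * y) r = epowr \<infinity> r * epowr y r" for y
    using r by (cases "y = 0") (auto simp: epowr_def ennreal_top_mult enn2real_eq_0_iff)
  show ?thesis
  proof (cases "x = \<infinity> \<or> y = \<infinity>")
    case True
    then show ?thesis using top[of x] top[of y] by (auto simp: mult.commute)
  next
    case False
    then show ?thesis
      by (auto simp: epowr_def ennreal_mult_eq_top_iff enn2real_mult powr_mult ennreal_mult)
  qed
qed

lemma epowr_ennreal: "0 \<le> x \<Longrightarrow> epowr (ennreal x) r = ennreal (x powr r)"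
  by (simp add: epowr_def)

lemma epowr_zero [simp]: "epowr 0 r = 0"
  by (simp add: epowr_def)

lemma borel_measurable_epowr [measurable]:
  assumes [measurable]: "f \<in> borel_measurable M"
  shows "(\<lambda>u. epowr (f u) r) \<in> borel_measurable M"
  unfolding epowr_def by measurable

lemma rec_exp_finite: "0 < p \<Longrightarrow> p < \<infinity> \<Longrightarrow> 0 < enn2real p \<and> rec_exp p = 1 / enn2real p"
  by (cases p) (auto simp: rec_exp_def enn2real_positive_iff ennreal_1[symmetric] divide_ennreal
      simp del: ennreal_1)

lemma rec_exp_top [simp]: "rec_exp top = 0"
  by (simp add: rec_exp_def)

lemma Lq_norm_top: "Lq_norm top S g = esssup (lebesgue_on S) g"
  by (simp add: Lq_norm_def)

lemma epowr_Lq_norm: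
  assumes "0 < p" "p < \<infinity>"
  shows "epowr (Lq_norm p S g) (enn2real p) = (\<integral>\<^sup>+u. epowr (g u) (enn2real p) \<partial>lebesgue_on S)"
  using rec_exp_finite[OF assms] assms by (auto simp add: Lq_norm_def epowr_inverse')

lemma epowr_le_iff: "0 < r \<Longrightarrow> epowr x r \<le> epowr y r \<longleftrightarrow> x \<le> y"
  by (metis epowr_inverse epowr_mono zero_less_divide_1_iff)

lemma Lq_norm_AE_mono:
  assumes p: "0 < p" and f: "f \<in> borel_measurable (lebesgue_on S)"
    and le: "AE u in lebesgue_on S. f u \<le> g u"
  shows "Lq_norm p S f \<le> Lq_norm p S g"
proof (cases "p = \<infinity>")
  case True
  then show ?thesis using esssup_AE_mono[OF f le] by (simp add: Lq_norm_def)
next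
  case False
  then have *: "0 < p" "p < \<infinity>" using p by (auto simp: less_top)
  then have q: "0 < enn2real p" using rec_exp_finite by blast
  have "(\<integral>\<^sup>+u. epowr (f u) (enn2real p) \<partial>lebesgue_on S) \<le> (\<integral>\<^sup>+u. epowr (g u) (enn2real p) \<partial>lebesgue_on S)"
    using le by (intro nn_integral_mono_AE) (auto intro: epowr_mono[OF _ q])
  then show ?thesis
    by (metis epowr_le_iff[OF q] epowr_Lq_norm[OF *])
qed

lemma Lq_norm_mono:
  assumes "0 < p" "f \<in> borel_measurable (lebesgue_on S)" "\<And>u. u \<in> S \<Longrightarrow> f u \<le> g u"
  shows "Lq_norm p S f \<le> Lq_norm p S g"
  by (rule Lq_norm_AE_mono) (use assms in auto)

lemma Lq_norm_cong:
  assumes "\<And>u. u \<in> S \<Longrightarrow> f u = g u"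
  shows "Lq_norm p S f = Lq_norm p S g"
proof -
  have "(\<integral>\<^sup>+u. epowr (f u) (enn2real p) \<partial>lebesgue_on S) = (\<integral>\<^sup>+u. epowr (g u) (enn2real p) \<partial>lebesgue_on S)"
    by (intro nn_integral_cong) (use assms in auto)
  moreover have "f \<in> borel_measurable (lebesgue_on S) \<longleftrightarrow> g \<in> borel_measurable (lebesgue_on S)"
    by (intro measurable_cong) (use assms in auto)
  moreover have "esssup (lebesgue_on S) f = esssup (lebesgue_on S) g"
  proof (cases "f \<in> borel_measurable (lebesgue_on S)")
    case True
    then show ?thesis using calculation(2) assms by (intro esssup_AE_cong) auto
  qed (simp add: esssup_non_measurable calculation(2))
  ultimately show ?thesis by (simp add: Lq_norm_def)
qed

lemma Lq_norm_zero [simp]: "0 < p \<Longrightarrow> Lq_norm p S (\<lambda>u. 0) = 0"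
proof -
  have "esssup (lebesgue_on S) (\<lambda>u. 0 :: ennreal) \<le> 0" by (rule esssup_I) auto
  then show "0 < p \<Longrightarrow> Lq_norm p S (\<lambda>u. 0) = 0" by (simp add: Lq_norm_def)
qed

text \<open>For \<open>p = \<infinity>\<close> one inequality is direct; the other one is the same inequality for the factor
  \<open>1/c\<close>.\<close>
lemma Lq_norm_cmult:
  assumes p: "0 < p" and f: "f \<in> borel_measurable (lebesgue_on S)" and c: "c < \<infinity>"
  shows "Lq_norm p S (\<lambda>u. c * f u) = c * Lq_norm p S f"
proof (cases "c = 0")
  case True
  then show ?thesis using p by simp
next
  case False
  then have c: "0 < c" "c < \<infinity>" using c by (auto simp: zero_less_iff_neq_zero)
  show ?thesis
proof (cases "p = \<infinity>")
  case True
  have le: "esssup (lebesgue_on S) (\<lambda>u. d * g u) \<le> d * esssup (lebesgue_on S) g"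
    if "g \<in> borel_measurable (lebesgue_on S)" for d and g :: "real \<Rightarrow> ennreal"
    using that esssup_AE[where M="lebesgue_on S" and f=g]
    by (intro esssup_I) (auto elim!: eventually_mono intro: mult_left_mono)
  have inv: "c * (inverse c * x) = x" "inverse c * (c * x) = x" for x
  proof -
    have "c * inverse c = 1"
      using ennreal_divide_self[of c] c by (simp add: divide_ennreal_def less_top)
    then show "c * (inverse c * x) = x" "inverse c * (c * x) = x"
      by (metis mult.assoc mult.commute mult_1)+
  qed
  have "esssup (lebesgue_on S) f \<le> inverse c * esssup (lebesgue_on S) (\<lambda>u. c * f u)"
    using le[of "\<lambda>u. c * f u" "inverse c"] f by (simp add: inv)
  then have "c * esssup (lebesgue_on S) f \<le> c * (inverse c * esssup (lebesgue_on S) (\<lambda>u. c * f u))"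
    by (rule mult_left_mono) simp
  then show ?thesis using True le[OF f, of c] by (auto simp: Lq_norm_top inv intro: antisym)
next
  case False
  then have *: "0 < p" "p < \<infinity>" using p by (auto simp: less_top)
  then have q: "0 < enn2real p" using rec_exp_finite by blast
  have "epowr (Lq_norm p S (\<lambda>u. c * f u)) (enn2real p) = epowr (c * Lq_norm p S f) (enn2real p)"
    using f by (simp add: epowr_Lq_norm[OF *] epowr_mult[OF q] nn_integral_cmult)
  then show ?thesis using epowr_le_iff[OF q] by (metis antisym order_refl)
qed
qed

lemma Lq_norm_mono_set:
  assumes p: "0 < p" and g: "g \<in> borel_measurable (lebesgue_on T)" and "S \<subseteq> T"
    "S \<in> sets lebesgue" "T \<in> sets lebesgue"
  shows "Lq_norm p S g \<le> Lq_norm p T g"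
proof (cases "p = \<infinity>")
  case True
  have gS: "g \<in> borel_measurable (lebesgue_on S)"
    using g \<open>S \<subseteq> T\<close> by (rule measurable_restrict_mono)
  have "AE u in lebesgue_on S. g u \<le> esssup (lebesgue_on T) g"
    using esssup_AE[where M="lebesgue_on T" and f=g] assms
    by (auto simp: AE_restrict_space_iff elim!: eventually_mono)
  then show ?thesis using True gS by (auto simp: Lq_norm_top)
next
  case False
  then have *: "0 < p" "p < \<infinity>" using p by (auto simp: less_top)
  then have q: "0 < enn2real p" using rec_exp_finite by blast
  have "epowr (Lq_norm p S g) (enn2real p) \<le> epowr (Lq_norm p T g) (enn2real p)"
    using assms unfolding epowr_Lq_norm[OF *]
    by (auto simp: nn_integral_restrict_space intro!: nn_integral_mono split: split_indicator)
  then show ?thesis using epowr_le_iff[OF q] by blast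
qed

lemma Lq_norm_indicator:
  assumes p: "0 < p" and "S \<subseteq> T" "S \<in> sets lebesgue" "T \<in> sets lebesgue"
    and g: "g \<in> borel_measurable (lebesgue_on T)"
  shows "Lq_norm p T (\<lambda>u. g u * indicator S u) = Lq_norm p S g"
proof (cases "p = \<infinity>")
  case True
  have gS: "g \<in> borel_measurable (lebesgue_on S)"
    using g \<open>S \<subseteq> T\<close> by (rule measurable_restrict_mono)
  have S': "S \<in> sets (lebesgue_on T)" using assms by (auto simp: sets_restrict_space)
  then have gT: "(\<lambda>u. g u * indicator S u) \<in> borel_measurable (lebesgue_on T)"
    using g by measurable
  have "(AE u in lebesgue_on T. g u * indicator S u \<le> z) \<longleftrightarrow> (AE u in lebesgue_on S. g u \<le> z)" for z
    using assms by (auto simp: AE_restrict_space_iff elim!: eventually_mono split: split_indicator)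
  then show ?thesis unfolding True infinity_ennreal_def Lq_norm_top esssup_eq_AE[OF gS] esssup_eq_AE[OF gT]
    by simp
next
  case False
  then have *: "0 < p" "p < \<infinity>" using p by (auto simp: less_top)
  have "epowr (g u * indicator S u) q * indicator T u = epowr (g u) q * indicator S u" for u q
    using \<open>S \<subseteq> T\<close> by (auto split: split_indicator)
  then show ?thesis using assms False
    by (simp add: Lq_norm_def nn_integral_restrict_space)
qed

text \<open>The factor \<open>2\<close> from \<open>x + y \<le> 2 max x y\<close>, which is applied to the integrands, times the factor
  \<open>2\<^sup>1\<^sup>/\<^sup>p\<close> from the same inequality for the two integrals.\<close>
definition triangle_const :: "ennreal \<Rightarrow> real" where
  "triangle_const p = 2 powr (1 + rec_exp p)"

lemma rec_exp_nonneg: "0 \<le> rec_exp p" by (simp add: rec_exp_def)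

lemma triangle_const_ge: "2 \<le> triangle_const p"
  using powr_mono[of 1 "1 + rec_exp p" 2] rec_exp_nonneg[of p] by (simp add: triangle_const_def)

text \<open>Valid for \<open>p < 1\<close> as well: bounding a sum by twice the maximum replaces convexity of the
  power.\<close>
lemma Lq_norm_triangle:
  assumes p: "0 < p" and f: "f \<in> borel_measurable (lebesgue_on S)"
    and g: "g \<in> borel_measurable (lebesgue_on S)"
  shows "Lq_norm p S (\<lambda>u. f u + g u) \<le> ennreal (triangle_const p) * (Lq_norm p S f + Lq_norm p S g)"
proof (cases "p = \<infinity>")
  case True
  have "AE u in lebesgue_on S. f u + g u \<le> esssup (lebesgue_on S) f + esssup (lebesgue_on S) g"
    using esssup_AE[where M="lebesgue_on S" and f=f] esssup_AE[where M="lebesgue_on S" and f=g]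
    by eventually_elim (rule add_mono)
  then have "Lq_norm p S (\<lambda>u. f u + g u) \<le> 1 * (Lq_norm p S f + Lq_norm p S g)"
    using True f g by (auto simp: Lq_norm_top)
  also have "\<dots> \<le> ennreal (triangle_const p) * (Lq_norm p S f + Lq_norm p S g)"
    using triangle_const_ge[of p] by (intro mult_right_mono) auto
  finally show ?thesis .
next
  case False
  then have *: "0 < p" "p < \<infinity>" using p by (auto simp: less_top)
  define q where "q = enn2real p"
  have q: "0 < q" "rec_exp p = 1 / q" using rec_exp_finite[OF *] by (auto simp: q_def)
  let ?M = "max (Lq_norm p S f) (Lq_norm p S g)"
  have add_max: "x + y \<le> 2 * max x y" for x y :: ennreal
    by (metis add_mono max.cobounded1 max.cobounded2 mult_2)
  have "epowr (f u + g u) q \<le> ennreal (2 powr q) * (epowr (f u) q + epowr (g u) q)" for u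
  proof -
    have "epowr (f u + g u) q \<le> epowr (2 * max (f u) (g u)) q"
      by (rule epowr_mono[OF add_max q(1)])
    also have "\<dots> = ennreal (2 powr q) * epowr (max (f u) (g u)) q"
      using epowr_ennreal[of 2 q] by (simp add: epowr_mult[OF q(1)])
    also have "epowr (max (f u) (g u)) q \<le> epowr (f u) q + epowr (g u) q"
      by (simp add: max_def)
    finally show ?thesis by (simp add: mult_left_mono)
  qed
  then have "epowr (Lq_norm p S (\<lambda>u. f u + g u)) q
      \<le> (\<integral>\<^sup>+u. ennreal (2 powr q) * (epowr (f u) q + epowr (g u) q) \<partial>lebesgue_on S)"
    unfolding q_def epowr_Lq_norm[OF *] by (intro nn_integral_mono)
  also have "\<dots> = ennreal (2 powr q) * (epowr (Lq_norm p S f) q + epowr (Lq_norm p S g) q)"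
    using f g unfolding epowr_Lq_norm[OF *] q_def
    by (simp add: nn_integral_cmult nn_integral_add)
  also have "\<dots> \<le> ennreal (2 powr q) * (2 * epowr ?M q)"
    using epowr_mono[OF max.cobounded1 q(1)] epowr_mono[OF max.cobounded2 q(1)]
    by (intro mult_left_mono) (auto simp: mult_2 intro: add_mono)
  also have "\<dots> = epowr (ennreal (triangle_const p) * ?M) q"
  proof -
    have "epowr (ennreal (triangle_const p)) q = ennreal (2 powr (q + 1))"
      using q by (simp add: epowr_ennreal triangle_const_def powr_powr field_simps)
    also have "\<dots> = ennreal (2 powr q) * 2"
      by (simp add: powr_add ennreal_mult)
    finally show ?thesis by (simp add: epowr_mult[OF q(1)] mult.assoc)
  qed
  finally have "Lq_norm p S (\<lambda>u. f u + g u) \<le> ennreal (triangle_const p) * ?M"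
    using epowr_le_iff[OF q(1)] by blast
  also have "\<dots> \<le> ennreal (triangle_const p) * (Lq_norm p S f + Lq_norm p S g)"
    by (intro mult_left_mono) (auto simp: max_def)
  finally show ?thesis .
qed

lemma Lq_norm_split:
  assumes p: "0 < p" and cover: "AE u in lebesgue_on T. u \<in> S \<union> R" and "S \<subseteq> T" "R \<subseteq> T"
    and m: "S \<in> sets lebesgue" "R \<in> sets lebesgue" "T \<in> sets lebesgue"
    and g: "g \<in> borel_measurable (lebesgue_on T)"
  shows "Lq_norm p T g \<le> ennreal (triangle_const p) * (Lq_norm p S g + Lq_norm p R g)"
proof -
  have "S \<in> sets (lebesgue_on T)" "R \<in> sets (lebesgue_on T)"
    using assms by (auto simp: sets_restrict_space)
  then have mm: "(\<lambda>u. g u * indicator S u) \<in> borel_measurable (lebesgue_on T)"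
     "(\<lambda>u. g u * indicator R u) \<in> borel_measurable (lebesgue_on T)"
    using g by measurable
  have "Lq_norm p T g \<le> Lq_norm p T (\<lambda>u. g u * indicator S u + g u * indicator R u)"
    using cover by (intro Lq_norm_AE_mono[OF p g]) (auto elim!: eventually_mono split: split_indicator)
  also have "\<dots> \<le> ennreal (triangle_const p) * (Lq_norm p S g + Lq_norm p R g)"
    using Lq_norm_triangle[OF p mm] assms by (simp add: Lq_norm_indicator)
  finally show ?thesis .
qed

section \<open>Comparison of weights over initial intervals\<close>

lemma sigma_finite_lebesgue_pos: "sigma_finite_measure (lebesgue_on {0::real<..})"
proof (rule sigma_finite_measure_restrict_space)
  obtain A where "countable A" "A \<subseteq> sets (lborel :: real measure)" "\<Union>A = UNIV"
    "\<forall>a\<in>A. emeasure (lborel :: real measure) a \<noteq> \<infinity>"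
    using lborel.sigma_finite_countable[where 'a=real] by auto
  then show "sigma_finite_measure (lebesgue :: real measure)"
    by (intro sigma_finite_measure.intro exI[of _ A]) (auto simp: subset_eq)
qed simp

text \<open>The superlevel sets of a non-increasing function on the half-line are down-closed, and a down-closed
  set is determined by its supremum up to the end point. This yields measurability of the function and, later, the
  reduction of the comparison principle to initial intervals.\<close>
lemma down_closed_cases:
  fixes D :: "real set"
  assumes sub: "D \<subseteq> {0<..}" and dc: "\<And>u v. v \<in> D \<Longrightarrow> 0 < u \<Longrightarrow> u \<le> v \<Longrightarrow> u \<in> D"
  shows "D = {0<..} \<or> D = {} \<or> (\<exists>r>0. D = {0<..<r} \<or> D = {0<..r})"
proof (cases "D = {} \<or> \<not> bdd_above D")
  case True
  then show ?thesis
  proof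
    assume nb: "\<not> bdd_above D"
    have "u \<in> D" if "0 < u" for u
    proof -
      obtain v where "v \<in> D" "u < v" using nb unfolding bdd_above_def by (metis not_le)
      then show ?thesis using dc that by auto
    qed
    then show ?thesis using sub by auto
  qed simp
next
  case False
  then have b: "bdd_above D" "D \<noteq> {}" by auto
  define r where "r = Sup D"
  have up: "u \<le> r" if "u \<in> D" for u using cSup_upper[OF that b(1)] by (simp add: r_def)
  have r0: "0 < r" using b(2) up sub by force
  have "u \<in> D" if "0 < u" "u < r" for u
    using less_cSup_iff[OF b(2,1), of u] dc that by (auto simp: r_def)
  then have "{0<..<r} \<subseteq> D" by auto
  moreover have "D \<subseteq> {0<..r}" using sub up by auto
  moreover have "{0<..r} = insert r {0<..<r}" using r0 by auto
  ultimately have "D = {0<..<r} \<or> D = {0<..r}"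
    by (cases "r \<in> D") auto
  then show ?thesis using r0 by blast
qed

lemma antimono_superlevel_cases:
  fixes k :: "real \<Rightarrow> ennreal"
  assumes "antimono_on {0<..} k"
  shows "{u \<in> {0<..}. a < k u} = {0<..} \<or> {u \<in> {0<..}. a < k u} = {} \<or>
    (\<exists>r>0. {u \<in> {0<..}. a < k u} = {0<..<r} \<or> {u \<in> {0<..}. a < k u} = {0<..r})"
proof (rule down_closed_cases)
  fix u v :: real assume "v \<in> {u \<in> {0<..}. a < k u}" "0 < u" "u \<le> v"
  then show "u \<in> {u \<in> {0<..}. a < k u}"
    using monotone_onD[OF assms, of u v] by auto
qed auto

lemma borel_measurable_antimono_on:
  fixes k :: "real \<Rightarrow> ennreal"
  assumes "antimono_on {0<..} k"
  shows "k \<in> borel_measurable (lebesgue_on {0<..})"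
proof (rule borel_measurableI_greater)
  fix a :: ennreal
  have "{u \<in> {0<..}. a < k u} \<in> sets lebesgue"
    using antimono_superlevel_cases[OF assms, of a] by (elim disjE exE conjE) (erule ssubst, simp)+
  then show "{x \<in> space (lebesgue_on {0<..}). a < k x} \<in> sets (lebesgue_on {0<..})"
    by (auto simp: sets_restrict_space_iff)
qed

text \<open>Each value \<open>k(u)\<close> is the length of \<open>{s. 0 < s < k(u)}\<close>; then the order of integration is
  exchanged.\<close>
lemma nn_integral_layer_cake:
  fixes k w :: "real \<Rightarrow> ennreal"
  assumes "sigma_finite_measure M"
    and k[measurable]: "k \<in> borel_measurable M" and w[measurable]: "w \<in> borel_measurable M"
  shows "(\<integral>\<^sup>+u. k u * w u \<partial>M) =
    (\<integral>\<^sup>+s. (\<integral>\<^sup>+u. w u * indicator {u. ennreal s < k u} u * indicator {0<..} s \<partial>M) \<partial>lborel)"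
proof -
  interpret M: sigma_finite_measure M by fact
  interpret P: pair_sigma_finite M "lborel :: real measure" ..
  have level: "(\<integral>\<^sup>+s. indicator {s. 0 < s \<and> ennreal s < y} s \<partial>lborel) = y" for y :: ennreal
  proof (cases y)
    case (real r)
    then have "{s. 0 < s \<and> ennreal s < y} = {0<..<r}" by (auto simp: ennreal_less_iff)
    then show ?thesis using real by simp
  next
    case top
    then have "{s. 0 < s \<and> ennreal s < y} = {0<..}" by auto
    moreover have "emeasure lborel {0::real<..} = \<infinity>"
    proof (rule ccontr)
      assume "emeasure lborel {0::real<..} \<noteq> \<infinity>"
      then obtain n where n: "emeasure lborel {0::real<..} < of_nat n"
        using ennreal_Ex_less_of_nat by (auto simp: less_top)
      have "emeasure lborel {0<..<real n} \<le> emeasure lborel {0::real<..}"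
        by (intro emeasure_mono) auto
      then show False using n by (simp add: ennreal_of_nat_eq_real_of_nat)
    qed
    ultimately show ?thesis using top by simp
  qed
  have "(\<integral>\<^sup>+u. k u * w u \<partial>M) =
      (\<integral>\<^sup>+u. (\<integral>\<^sup>+s. w u * indicator {u. ennreal s < k u} u * indicator {0<..} s \<partial>lborel) \<partial>M)"
  proof (rule nn_integral_cong)
    fix u
    have "k u * w u = w u * (\<integral>\<^sup>+s. indicator {s. 0 < s \<and> ennreal s < k u} s \<partial>lborel)"
      by (simp only: level mult.commute)
    also have "\<dots> = (\<integral>\<^sup>+s. w u * indicator {s. 0 < s \<and> ennreal s < k u} s \<partial>lborel)"
      by (rule nn_integral_cmult[symmetric]) measurable
    also have "\<dots> = (\<integral>\<^sup>+s. w u * indicator {u. ennreal s < k u} u * indicator {0<..} s \<partial>lborel)"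
      by (intro nn_integral_cong) (auto split: split_indicator)
    finally show "k u * w u = \<dots>" .
  qed
  also have "\<dots> = (\<integral>\<^sup>+s. (\<integral>\<^sup>+u. w u * indicator {u. ennreal s < k u} u * indicator {0<..} s \<partial>M) \<partial>lborel)"
    by (rule P.Fubini'[symmetric]) measurable
  finally show ?thesis .
qed

text \<open>Slice \<open>k\<close> into layers: every layer integrates \<open>w0\<close> and \<open>w1\<close> over a superlevel set of
  \<open>k\<close>, which is an initial interval up to a null set.\<close>
lemma nn_integral_Hardy:
  fixes k w0 w1 :: "real \<Rightarrow> ennreal"
  assumes k: "antimono_on {0<..} k"
    and w0: "w0 \<in> borel_measurable (lebesgue_on {0<..})"
    and w1: "w1 \<in> borel_measurable (lebesgue_on {0<..})"
    and le: "\<And>r. 0 < r \<Longrightarrow> (\<integral>\<^sup>+u. w0 u \<partial>lebesgue_on {0<..<r}) \<le> (\<integral>\<^sup>+u. w1 u \<partial>lebesgue_on {0<..<r})"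
  shows "(\<integral>\<^sup>+u. k u * w0 u \<partial>lebesgue_on {0<..}) \<le> (\<integral>\<^sup>+u. k u * w1 u \<partial>lebesgue_on {0<..})"
proof -
  let ?M = "lebesgue_on {0::real<..}"
  have sets[measurable]: "{0<..<r} \<in> sets ?M" "{0<..r} \<in> sets ?M" for r :: real
    by (auto simp: sets_restrict_space)
  have ivl: "(\<integral>\<^sup>+u. w u * indicator {0<..<r} u \<partial>?M) = (\<integral>\<^sup>+u. w u \<partial>lebesgue_on {0<..<r})"
    for w :: "real \<Rightarrow> ennreal" and r
    by (auto simp: nn_integral_restrict_space intro!: nn_integral_cong split: split_indicator)
  have le': "(\<integral>\<^sup>+u. w0 u * indicator {0<..<r} u \<partial>?M) \<le> (\<integral>\<^sup>+u. w1 u * indicator {0<..<r} u \<partial>?M)"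
    if "0 < r" for r using le[OF that] by (simp only: ivl)
  \<comment> \<open>The superlevel set may be the whole half-line, which is reached by monotone convergence.\<close>
  have full: "(\<integral>\<^sup>+u. w0 u \<partial>?M) \<le> (\<integral>\<^sup>+u. w1 u \<partial>?M)"
  proof -
    have sup: "(SUP n. w0 u * indicator {0<..<real (Suc n)} u) = w0 u" if "0 < u" for u
    proof (rule antisym)
      show "(SUP n. w0 u * indicator {0<..<real (Suc n)} u) \<le> w0 u"
        by (rule SUP_least) (auto split: split_indicator)
      obtain n where "u < real n" using reals_Archimedean2 by blast
      then show "w0 u \<le> (SUP n. w0 u * indicator {0<..<real (Suc n)} u)"
        using that by (intro SUP_upper2[of n]) auto
    qed
    have "(\<integral>\<^sup>+u. w0 u \<partial>?M) = (\<integral>\<^sup>+u. (SUP n. w0 u * indicator {0<..<real (Suc n)} u) \<partial>?M)"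
      by (intro nn_integral_cong) (simp add: sup del: of_nat_Suc)
    also have "\<dots> = (SUP n. \<integral>\<^sup>+u. w0 u * indicator {0<..<real (Suc n)} u \<partial>?M)"
      using w0 by (intro nn_integral_monotone_convergence_SUP)
        (auto simp: incseq_def le_fun_def split: split_indicator)
    also have "\<dots> \<le> (\<integral>\<^sup>+u. w1 u \<partial>?M)"
    proof (rule SUP_least)
      fix n
      have "(\<integral>\<^sup>+u. w0 u * indicator {0<..<real (Suc n)} u \<partial>?M)
          \<le> (\<integral>\<^sup>+u. w1 u * indicator {0<..<real (Suc n)} u \<partial>?M)" by (rule le') simp
      also have "\<dots> \<le> (\<integral>\<^sup>+u. w1 u \<partial>?M)"
        by (rule nn_integral_mono) (auto split: split_indicator)
      finally show "(\<integral>\<^sup>+u. w0 u * indicator {0<..<real (Suc n)} u \<partial>?M) \<le> (\<integral>\<^sup>+u. w1 u \<partial>?M)" .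
    qed
    finally show ?thesis .
  qed
  have "(\<integral>\<^sup>+u. w0 u * indicator {u. ennreal s < k u} u * indicator {0<..} s \<partial>?M)
      \<le> (\<integral>\<^sup>+u. w1 u * indicator {u. ennreal s < k u} u * indicator {0<..} s \<partial>?M)" for s :: real
  proof -
    have restr: "(\<integral>\<^sup>+u. w u * indicator {u. ennreal s < k u} u * indicator {0<..} s \<partial>?M)
        = (\<integral>\<^sup>+u. w u * indicator {u \<in> {0<..}. ennreal s < k u} u \<partial>?M) * indicator {0<..} s"
      for w :: "real \<Rightarrow> ennreal"
      by (cases "0 < s") (auto intro!: nn_integral_cong split: split_indicator)
    have closed: "(\<integral>\<^sup>+u. w u * indicator {0<..r} u \<partial>?M) = (\<integral>\<^sup>+u. w u * indicator {0<..<r} u \<partial>?M)"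
      for w :: "real \<Rightarrow> ennreal" and r
    proof (rule nn_integral_cong_AE)
      have "AE u in lebesgue. u \<noteq> r" by (intro AE_completion) (rule AE_lborel_singleton)
      then have "AE u in ?M. u \<noteq> r" by (subst AE_restrict_space_iff) auto
      then show "AE u in ?M. w u * indicator {0<..r} u = w u * indicator {0<..<r} u"
        by eventually_elim (auto split: split_indicator)
    qed
    have pos: "(\<integral>\<^sup>+u. w u * indicator {0<..} u \<partial>?M) = (\<integral>\<^sup>+u. w u \<partial>?M)"
      for w :: "real \<Rightarrow> ennreal"
      by (rule nn_integral_cong) simp
    show ?thesis unfolding restr using antimono_superlevel_cases[OF k, of "ennreal s"]
      by (intro mult_right_mono) (elim disjE exE conjE, simp_all add: closed pos full le')
  qed
  then show ?thesis
    unfolding nn_integral_layer_cake[OF sigma_finite_lebesgue_pos borel_measurable_antimono_on[OF k] w0]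
      nn_integral_layer_cake[OF sigma_finite_lebesgue_pos borel_measurable_antimono_on[OF k] w1]
    by (rule nn_integral_mono)
qed

text \<open>For finite \<open>p\<close> the previous lemma applies to \<open>k\<^sup>p\<close> and the powers of the weights. For \<open>p = \<infinity>\<close>
  the hypothesis bounds \<open>w0\<close> on \<open>(0,r)\<close> by the supremum of \<open>w1\<close>, hence \<open>k(r) w0(u)\<close> by the right-hand
  norm for almost all \<open>u < r\<close>. Choosing a rational \<open>r\<close> between \<open>u\<close> and \<open>2 u\<close> replaces \<open>k(r)\<close> by
  \<open>k(u)\<close> at the cost of the factor \<open>2\<close>.\<close>
lemma Lq_norm_Hardy:
  fixes k w0 w1 :: "real \<Rightarrow> ennreal"
  assumes p: "0 < p"
    and k: "antimono_on {0<..} k"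
    and dbl: "\<And>u r. 0 < u \<Longrightarrow> u < r \<Longrightarrow> r < 2 * u \<Longrightarrow> k u \<le> 2 * k r"
    and fin: "\<And>u. 0 < u \<Longrightarrow> k u < \<infinity>"
    and w0: "w0 \<in> borel_measurable (lebesgue_on {0<..})"
    and w1: "w1 \<in> borel_measurable (lebesgue_on {0<..})"
    and le: "\<And>r. 0 < r \<Longrightarrow> Lq_norm p {0<..<r} w0 \<le> Lq_norm p {0<..<r} w1"
  shows "Lq_norm p {0<..} (\<lambda>u. k u * w0 u) \<le> 2 * Lq_norm p {0<..} (\<lambda>u. k u * w1 u)"
proof (cases "p = \<infinity>")
  case False
  then have *: "0 < p" "p < \<infinity>" using p by (auto simp: less_top)
  define q where "q = enn2real p"
  have q: "0 < q" using rec_exp_finite[OF *] by (auto simp: q_def)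
  have kq: "antimono_on {0<..} (\<lambda>u. epowr (k u) q)"
    using k q by (auto simp: monotone_on_def intro!: epowr_mono)
  have "epowr (Lq_norm p {0<..} (\<lambda>u. k u * w0 u)) q \<le> epowr (Lq_norm p {0<..} (\<lambda>u. k u * w1 u)) q"
    unfolding epowr_Lq_norm[OF *, folded q_def] epowr_mult[OF q]
  proof (rule nn_integral_Hardy[OF kq])
    fix r :: real assume "0 < r"
    then have "epowr (Lq_norm p {0<..<r} w0) q \<le> epowr (Lq_norm p {0<..<r} w1) q"
      by (intro epowr_mono le q)
    then show "(\<integral>\<^sup>+u. epowr (w0 u) q \<partial>lebesgue_on {0<..<r})
        \<le> (\<integral>\<^sup>+u. epowr (w1 u) q \<partial>lebesgue_on {0<..<r})"
      by (simp add: q_def epowr_Lq_norm[OF *])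
  qed (use w0 w1 in measurable)
  then have "1 * Lq_norm p {0<..} (\<lambda>u. k u * w0 u) \<le> 1 * Lq_norm p {0<..} (\<lambda>u. k u * w1 u)"
    using epowr_le_iff[OF q] by simp
  also have "\<dots> \<le> 2 * Lq_norm p {0<..} (\<lambda>u. k u * w1 u)" by (intro mult_right_mono) auto
  finally show ?thesis by simp
next
  case True
  define m where "m = Lq_norm p {0<..} (\<lambda>u. k u * w1 u)"
  have kw0: "(\<lambda>u. k u * w0 u) \<in> borel_measurable (lebesgue_on {0<..})"
    using borel_measurable_antimono_on[OF k] w0 by measurable
  have kw1: "(\<lambda>u. k u * w1 u) \<in> borel_measurable (lebesgue_on {0<..})"
    using borel_measurable_antimono_on[OF k] w1 by measurable
  have step: "AE u in lebesgue_on {0<..}. u < r \<longrightarrow> k r * w0 u \<le> m" if r: "0 < r" for r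
  proof -
    have w1r: "w1 \<in> borel_measurable (lebesgue_on {0<..<r})"
      using w1 by (rule measurable_restrict_mono) auto
    have "k r * Lq_norm p {0<..<r} w0 \<le> k r * Lq_norm p {0<..<r} w1"
      by (intro mult_left_mono le r) simp
    also have "\<dots> = Lq_norm p {0<..<r} (\<lambda>u. k r * w1 u)"
      using fin[OF r] by (intro Lq_norm_cmult[OF p w1r, symmetric])
    also have "\<dots> \<le> Lq_norm p {0<..<r} (\<lambda>u. k u * w1 u)"
      using w1r r monotone_onD[OF k]
      by (intro Lq_norm_mono[OF p]) (auto intro!: mult_right_mono)
    also have "\<dots> \<le> m" unfolding m_def by (intro Lq_norm_mono_set[OF p kw1]) auto
    finally have le_m: "k r * Lq_norm p {0<..<r} w0 \<le> m" .
    have "AE u in lebesgue_on {0<..<r}. w0 u \<le> Lq_norm p {0<..<r} w0"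
      using esssup_AE[where M="lebesgue_on {0<..<r}" and f=w0] True by (simp add: Lq_norm_top)
    then have "AE u in lebesgue_on {0<..<r}. k r * w0 u \<le> m"
      by eventually_elim (rule order_trans[OF mult_left_mono le_m], auto)
    then show ?thesis
      by (auto simp: AE_restrict_space_iff elim!: eventually_mono)
  qed
  \<comment> \<open>The exceptional null set depends on the radius, so only countably many radii are used.\<close>
  have "AE u in lebesgue_on {0<..}. \<forall>r\<in>\<rat> \<inter> {0<..}. u < r \<longrightarrow> k r * w0 u \<le> m"
    using step by (subst AE_ball_countable) (auto intro: countable_Int1 countable_rat)
  then have "AE u in lebesgue_on {0<..}. k u * w0 u \<le> 2 * m"
  proof (rule AE_mp, intro AE_I2 impI)
    fix u :: real assume "u \<in> space (lebesgue_on {0<..})"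
      and a: "\<forall>r\<in>\<rat> \<inter> {0<..}. u < r \<longrightarrow> k r * w0 u \<le> m"
    then have u: "0 < u" by simp
    then obtain r where r: "r \<in> \<rat>" "u < r" "r < 2 * u"
      using Rats_dense_in_real[of u "2 * u"] by auto
    have "k u * w0 u \<le> 2 * k r * w0 u" by (intro mult_right_mono dbl u r) simp
    also have "\<dots> \<le> 2 * m" using a r u by (auto simp: mult.assoc intro!: mult_left_mono)
    finally show "k u * w0 u \<le> 2 * m" .
  qed
  then show ?thesis using True kw0 by (auto simp: Lq_norm_top m_def)
qed

text \<open>The comparison principle for \<open>w0\<close> cut off to \<open>(0,t)\<close>, so that the comparison at a radius
  beyond \<open>t\<close> follows from the one at \<open>t\<close>.\<close>
lemma initial_part_le:
  fixes k w0 w1 :: "real \<Rightarrow> ennreal"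
  assumes p: "0 < p"
    and k: "antimono_on {0<..} k"
    and dbl: "\<And>u r. 0 < u \<Longrightarrow> u < r \<Longrightarrow> r < 2 * u \<Longrightarrow> k u \<le> 2 * k r"
    and fin: "\<And>u. 0 < u \<Longrightarrow> k u < \<infinity>"
    and w0: "w0 \<in> borel_measurable (lebesgue_on {0<..})"
    and w1: "w1 \<in> borel_measurable (lebesgue_on {0<..})"
    and e: "e < \<infinity>" and t: "0 < t"
    and le: "\<And>r. 0 < r \<Longrightarrow> r \<le> t \<Longrightarrow> Lq_norm p {0<..<r} w0 \<le> e * Lq_norm p {0<..<r} w1"
  shows "Lq_norm p {0<..<t} (\<lambda>u. k u * w0 u) \<le> 2 * (e * Lq_norm p {0<..} (\<lambda>u. k u * w1 u))"
proof -
  note [measurable] = borel_measurable_antimono_on[OF k] w0 w1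
  have [measurable]: "{0<..<t} \<in> sets (lebesgue_on {0<..})" by (auto simp: sets_restrict_space)
  have kw0: "(\<lambda>u. k u * w0 u) \<in> borel_measurable (lebesgue_on {0<..})" by measurable
  have kw1: "(\<lambda>u. k u * w1 u) \<in> borel_measurable (lebesgue_on {0<..})" by measurable
  have w0t: "(\<lambda>u. w0 u * indicator {0<..<t} u) \<in> borel_measurable (lebesgue_on {0<..})" by measurable
  have w1r: "w1 \<in> borel_measurable (lebesgue_on {0<..<r})" for r
    by (rule measurable_restrict_mono[OF w1]) auto
  have cut: "Lq_norm p {0<..<r} (\<lambda>u. w0 u * indicator {0<..<t} u) = Lq_norm p {0<..<min r t} w0" for r
  proof -
    have "Lq_norm p {0<..<r} (\<lambda>u. w0 u * indicator {0<..<t} u)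
        = Lq_norm p {0<..<r} (\<lambda>u. w0 u * indicator {0<..<min r t} u)"
      by (rule Lq_norm_cong) (auto split: split_indicator)
    also have "\<dots> = Lq_norm p {0<..<min r t} w0"
      by (intro Lq_norm_indicator[OF p] measurable_restrict_mono[OF w0]) auto
    finally show ?thesis .
  qed
  have "Lq_norm p {0<..<t} (\<lambda>u. k u * w0 u) = Lq_norm p {0<..} (\<lambda>u. k u * w0 u * indicator {0<..<t} u)"
    using kw0 by (intro Lq_norm_indicator[OF p, symmetric]) auto
  also have "\<dots> = Lq_norm p {0<..} (\<lambda>u. k u * (w0 u * indicator {0<..<t} u))"
    by (simp add: mult.assoc)
  also have "\<dots> \<le> 2 * Lq_norm p {0<..} (\<lambda>u. k u * (e * w1 u))"
  proof (rule Lq_norm_Hardy[OF p k dbl fin w0t])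
    fix r :: real assume r: "0 < r"
    have "Lq_norm p {0<..<min r t} w0 \<le> e * Lq_norm p {0<..<min r t} w1"
      using r t by (intro le) auto
    also have "\<dots> \<le> e * Lq_norm p {0<..<r} w1"
      by (intro mult_left_mono Lq_norm_mono_set[OF p] w1r) auto
    also have "\<dots> = Lq_norm p {0<..<r} (\<lambda>u. e * w1 u)"
      by (rule Lq_norm_cmult[OF p w1r e, symmetric])
    finally show "Lq_norm p {0<..<r} (\<lambda>u. w0 u * indicator {0<..<t} u)
        \<le> Lq_norm p {0<..<r} (\<lambda>u. e * w1 u)" by (simp add: cut)
  qed auto
  also have "(\<lambda>u. k u * (e * w1 u)) = (\<lambda>u. e * (k u * w1 u))" by (simp add: mult_ac)
  also have "Lq_norm p {0<..} \<dots> = e * Lq_norm p {0<..} (\<lambda>u. k u * w1 u)"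
    by (rule Lq_norm_cmult[OF p kw1 e])
  finally show ?thesis .
qed

text \<open>The counterpart for \<open>w1\<close> cut off to \<open>(t,\<infinity>)\<close>: for radii below \<open>t\<close> the cut-off weight vanishes.\<close>
lemma final_part_le:
  fixes k w0 w1 :: "real \<Rightarrow> ennreal"
  assumes p: "0 < p"
    and k: "antimono_on {0<..} k"
    and dbl: "\<And>u r. 0 < u \<Longrightarrow> u < r \<Longrightarrow> r < 2 * u \<Longrightarrow> k u \<le> 2 * k r"
    and fin: "\<And>u. 0 < u \<Longrightarrow> k u < \<infinity>"
    and w0: "w0 \<in> borel_measurable (lebesgue_on {0<..})"
    and w1: "w1 \<in> borel_measurable (lebesgue_on {0<..})"
    and e: "e < \<infinity>" and t: "0 < t"
    and le: "\<And>r. t \<le> r \<Longrightarrow> e * Lq_norm p {0<..<r} w1 \<le> Lq_norm p {0<..<r} w0"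
  shows "e * Lq_norm p {t<..} (\<lambda>u. k u * w1 u) \<le> 2 * Lq_norm p {0<..} (\<lambda>u. k u * w0 u)"
proof -
  note [measurable] = borel_measurable_antimono_on[OF k] w0 w1
  have [measurable]: "{t<..} \<in> sets (lebesgue_on {0<..})" using t by (auto simp: sets_restrict_space)
  have kw1: "(\<lambda>u. k u * w1 u) \<in> borel_measurable (lebesgue_on {0<..})" by measurable
  have kw1t: "(\<lambda>u. k u * w1 u) \<in> borel_measurable (lebesgue_on {t<..})"
    by (rule measurable_restrict_mono[OF kw1]) (use t in auto)
  have ew1: "(\<lambda>u. e * w1 u) \<in> borel_measurable (lebesgue_on {0<..})" by measurable
  have w1t: "(\<lambda>u. e * w1 u * indicator {t<..} u) \<in> borel_measurable (lebesgue_on {0<..})" by measurable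
  have kw1e: "(\<lambda>u. k u * (e * w1 u)) \<in> borel_measurable (lebesgue_on {0<..})" by measurable
  have w1r: "w1 \<in> borel_measurable (lebesgue_on {0<..<r})" for r
    by (rule measurable_restrict_mono[OF w1]) auto
  have "e * Lq_norm p {t<..} (\<lambda>u. k u * w1 u) = Lq_norm p {t<..} (\<lambda>u. e * (k u * w1 u))"
    by (rule Lq_norm_cmult[OF p kw1t e, symmetric])
  also have "(\<lambda>u. e * (k u * w1 u)) = (\<lambda>u. k u * (e * w1 u))" by (simp add: mult_ac)
  also have "Lq_norm p {t<..} (\<lambda>u. k u * (e * w1 u)) = Lq_norm p {0<..} (\<lambda>u. k u * (e * w1 u) * indicator {t<..} u)"
    using t kw1e by (intro Lq_norm_indicator[OF p, symmetric]) auto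
  also have "\<dots> = Lq_norm p {0<..} (\<lambda>u. k u * (e * w1 u * indicator {t<..} u))"
    by (simp add: mult.assoc)
  also have "\<dots> \<le> 2 * Lq_norm p {0<..} (\<lambda>u. k u * w0 u)"
  proof (rule Lq_norm_Hardy[OF p k dbl fin w1t w0])
    fix r :: real assume r: "0 < r"
    have m: "(\<lambda>u. e * w1 u * indicator {t<..} u) \<in> borel_measurable (lebesgue_on {0<..<r})"
      by (rule measurable_restrict_mono[OF w1t]) auto
    show "Lq_norm p {0<..<r} (\<lambda>u. e * w1 u * indicator {t<..} u) \<le> Lq_norm p {0<..<r} w0"
    proof (cases "t \<le> r")
      case True
      have "Lq_norm p {0<..<r} (\<lambda>u. e * w1 u * indicator {t<..} u) \<le> Lq_norm p {0<..<r} (\<lambda>u. e * w1 u)"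
        by (intro Lq_norm_mono[OF p m]) (auto split: split_indicator)
      also have "\<dots> = e * Lq_norm p {0<..<r} w1" by (rule Lq_norm_cmult[OF p w1r e])
      also have "\<dots> \<le> Lq_norm p {0<..<r} w0" by (rule le[OF True])
      finally show ?thesis .
    next
      case False
      then show ?thesis by (intro Lq_norm_mono[OF p m]) (auto split: split_indicator)
    qed
  qed auto
  finally show ?thesis .
qed

section \<open>Slowly varying weights\<close>

lemma borel_measurable_lebesgue_on:
  "f \<in> borel_measurable borel \<Longrightarrow> f \<in> borel_measurable (lebesgue_on S)"
  by (intro measurable_restrict_space1 measurable_completion) simp

lemma powr_measurable_lebesgue_on [measurable]:
  fixes a :: real
  shows "(\<lambda>u. u powr a) \<in> borel_measurable (lebesgue_on S)"
  by (rule borel_measurable_lebesgue_on) measurable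

lemma ident_measurable_lebesgue_on [measurable]:
  "(\<lambda>u. u) \<in> borel_measurable (lebesgue_on (S :: real set))"
  by (rule borel_measurable_lebesgue_on) measurable

lemma nn_integral_lebesgue_on_has_integral:
  fixes f :: "real \<Rightarrow> real"
  assumes "S \<in> sets lebesgue" "\<And>u. u \<in> S \<Longrightarrow> 0 \<le> f u" "(f has_integral I) S"
  shows "(\<integral>\<^sup>+u. ennreal (f u) \<partial>lebesgue_on S) = ennreal I"
  using nn_integral_has_integral_lebesgue'[OF assms(2,3)] assms(1)
  by (simp add: nn_integral_restrict_space nn_integral_completion)

text \<open>A slowly varying factor is compared with the powers \<open>1/2\<close> and \<open>-1/2\<close>; this lemma and the next one
  are the model computations for these powers.\<close>
lemma Lq_norm_powr_tail:
  assumes p: "0 < p"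
  shows "\<exists>c>0. \<forall>t>0. Lq_norm p {t<..} (\<lambda>u. ennreal (u powr (- (1/2) - rec_exp p))) \<le> ennreal (c * t powr (- (1/2)))"
proof (cases "p = \<infinity>")
  case True
  have "Lq_norm p {t<..} (\<lambda>u. ennreal (u powr (- (1/2) - rec_exp p))) \<le> ennreal (1 * t powr (- (1/2)))"
    if "0 < t" for t
    using that True by (auto simp: Lq_norm_top intro!: esssup_I powr_mono2' ennreal_leI AE_I2
      intro: measurable_compose[OF powr_measurable_lebesgue_on])
  then show ?thesis by (meson zero_less_one)
next
  case False
  then have *: "0 < p" "p < \<infinity>" using p by (auto simp: less_top)
  define q where "q = enn2real p"
  have q: "0 < q" "rec_exp p = 1 / q" using rec_exp_finite[OF *] by (auto simp: q_def)
  define c where "c = (2 / q) powr (1 / q)"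
  have "Lq_norm p {t<..} (\<lambda>u. ennreal (u powr (- (1/2) - rec_exp p))) = ennreal (c * t powr (- (1/2)))"
    if t: "0 < t" for t
  proof -
    have "((\<lambda>u. u powr (- (q/2) - 1)) has_integral (t powr (- (q/2)) * (2 / q))) {t..}"
      using has_integral_powr_to_inf[of "- (q/2) - 1" t] t q by simp
    then have I: "((\<lambda>u. u powr (- (q/2) - 1)) has_integral (t powr (- (q/2)) * (2 / q))) {t<..}"
      by (subst has_integral_spike_set_eq[of _ "{t..}"])
        (auto intro: negligible_subset[of "{t}"])
    have e: "(- (1/2) - 1 / q) * q = - (q/2) - 1" using q by (simp add: field_simps)
    have "(\<integral>\<^sup>+u. epowr (ennreal (u powr (- (1/2) - rec_exp p))) q \<partial>lebesgue_on {t<..})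
       = ennreal (t powr (- (q/2)) * (2 / q))"
      using nn_integral_lebesgue_on_has_integral[OF _ _ I]
      by (simp add: epowr_ennreal powr_powr q(2) e)
    then have "Lq_norm p {t<..} (\<lambda>u. ennreal (u powr (- (1/2) - rec_exp p))) =
        epowr (ennreal (t powr (- (q/2)) * (2 / q))) (1 / q)"
      using False by (simp add: Lq_norm_def q_def)
    also have "\<dots> = ennreal ((t powr (- (q/2)) * (2 / q)) powr (1 / q))"
      using q by (intro epowr_ennreal) simp
    also have "(t powr (- (q/2)) * (2 / q)) powr (1 / q) = c * t powr (- (1/2))"
      using q by (simp add: powr_mult powr_powr c_def powr_divide)
    finally show ?thesis .
  qed
  moreover have "c > 0" using q by (simp add: c_def)
  ultimately show ?thesis by (metis order_refl)
qed

lemma Lq_norm_powr_initial: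
  assumes p: "0 < p"
  shows "\<exists>c>0. \<forall>t>0. ennreal (c * t powr (1/2)) \<le> Lq_norm p {0<..<t} (\<lambda>u. ennreal (u powr (1/2 - rec_exp p)))"
proof (cases "p = \<infinity>")
  case True
  have "ennreal (1/2 * t powr (1/2)) \<le> Lq_norm p {0<..<t} (\<lambda>u. ennreal (u powr (1/2 - rec_exp p)))"
    if t: "0 < t" for t
  proof -
    \<comment> \<open>On the interval from \<open>t/4\<close> to \<open>t\<close> the square root is at least half of its value at \<open>t\<close>.\<close>
    have "ennreal (1/2 * t powr (1/2)) = ennreal ((t/4) powr (1/2))"
      using t real_sqrt_divide[of t 4] by (simp add: powr_half_sqrt)
    also have "\<dots> = Lq_norm p {t/4<..<t} (\<lambda>u. ennreal ((t/4) powr (1/2)))"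
      using t unfolding True infinity_ennreal_def Lq_norm_top
      by (intro esssup_const[symmetric]) (simp add: emeasure_restrict_space)
    also have "\<dots> \<le> Lq_norm p {t/4<..<t} (\<lambda>u. ennreal (u powr (1/2 - rec_exp p)))"
      using t True by (intro Lq_norm_mono[OF p]) (auto intro!: ennreal_leI powr_mono2)
    also have "\<dots> \<le> Lq_norm p {0<..<t} (\<lambda>u. ennreal (u powr (1/2 - rec_exp p)))"
      using t by (intro Lq_norm_mono_set[OF p]) auto
    finally show ?thesis .
  qed
  then show ?thesis by (intro exI[of _ "1/2"]) auto
next
  case False
  then have *: "0 < p" "p < \<infinity>" using p by (auto simp: less_top)
  define q where "q = enn2real p"
  have q: "0 < q" "rec_exp p = 1 / q" using rec_exp_finite[OF *] by (auto simp: q_def)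
  define c where "c = (2 / q) powr (1 / q)"
  have "Lq_norm p {0<..<t} (\<lambda>u. ennreal (u powr (1/2 - rec_exp p))) = ennreal (c * t powr (1/2))"
    if t: "0 < t" for t
  proof -
    have "((\<lambda>u. u powr (q/2 - 1)) has_integral (t powr (q/2) * (2 / q))) {0..t}"
      using has_integral_powr_from_0[of "q/2 - 1" t] t q by simp
    then have I: "((\<lambda>u. u powr (q/2 - 1)) has_integral (t powr (q/2) * (2 / q))) {0<..<t}"
      by (subst has_integral_spike_set_eq[of _ "{0..t}"])
        (auto intro: negligible_subset[of "{0,t}"])
    have e: "(1/2 - 1 / q) * q = q/2 - 1" using q by (simp add: field_simps)
    have "(\<integral>\<^sup>+u. epowr (ennreal (u powr (1/2 - rec_exp p))) q \<partial>lebesgue_on {0<..<t})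
       = ennreal (t powr (q/2) * (2 / q))"
      using nn_integral_lebesgue_on_has_integral[OF _ _ I]
      by (simp add: epowr_ennreal powr_powr q(2) e)
    then have "Lq_norm p {0<..<t} (\<lambda>u. ennreal (u powr (1/2 - rec_exp p))) =
        epowr (ennreal (t powr (q/2) * (2 / q))) (1 / q)"
      using False by (simp add: Lq_norm_def q_def)
    also have "\<dots> = ennreal ((t powr (q/2) * (2 / q)) powr (1 / q))"
      using q by (intro epowr_ennreal) simp
    also have "(t powr (q/2) * (2 / q)) powr (1 / q) = c * t powr (1/2)"
      using q by (simp add: powr_mult powr_powr c_def powr_divide)
    finally show ?thesis .
  qed
  moreover have "c > 0" using q by (simp add: c_def)
  ultimately show ?thesis by (metis order_refl)
qed

lemma inverse_vimage_eq: "{u \<in> {0::real<..}. 1 / u \<in> A} = (\<lambda>u. 1 / u) ` (A \<inter> {0<..})"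
proof -
  have "u = 1 / (1 / u)" "1 / u > 0" if "0 < u" for u :: real using that by auto
  then show ?thesis by (auto simp: image_iff intro!: bexI[where x="1 / _"])
qed

lemma inverse_differentiable_on: "A \<subseteq> {0::real<..} \<Longrightarrow> (\<lambda>u::real. 1 / u) differentiable_on A"
  by (auto simp: differentiable_on_def intro!: derivative_intros)

text \<open>Inversion is a diffeomorphism of the half-line, so it preserves Lebesgue measurability and not only
  Borel measurability. The class \<open>SV1\<close> is defined through \<open>b(1/t)\<close>, and this carries
  measurability over to \<open>b\<close>.\<close>
lemma measurable_inverse_pos: "(\<lambda>u::real. 1 / u) \<in> lebesgue_on {0<..} \<rightarrow>\<^sub>M lebesgue_on {0<..}"
proof (rule measurableI)
  fix A :: "real set" assume "A \<in> sets (lebesgue_on {0<..})"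
  then have A: "A \<in> sets lebesgue" "A \<subseteq> {0<..}" by (auto simp: sets_restrict_space_iff)
  have "(\<lambda>u. 1 / u) ` (A \<inter> {0<..}) \<in> sets lebesgue"
    using A by (intro differentiable_image_in_sets_lebesgue inverse_differentiable_on) auto
  then show "(\<lambda>u. 1 / u) -` A \<inter> space (lebesgue_on {0<..}) \<in> sets (lebesgue_on {0<..})"
    using inverse_vimage_eq[of A]
    by (auto simp: sets_restrict_space_iff vimage_def Int_def conj_commute)
qed auto

text \<open>The function whose \<open>L\<^sup>p\<close> quasi-norms over \<open>(0,t)\<close> are the two terms of the quotient \<open>\<eta>\<close>. The interpolation quasi-norms have the
  same weight if \<open>K(u,f)\<close> is replaced by \<open>K(u,f)/u\<close>.\<close>
definition weight :: "ennreal \<Rightarrow> (real \<Rightarrow> real) \<Rightarrow> real \<Rightarrow> ennreal" where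
  "weight p b = (\<lambda>u. ennreal (u powr (- rec_exp p) * b u))"

lemma SV1_measurable:
  assumes "b \<in> SV1 p"
  shows "b \<in> borel_measurable (lebesgue_on {0<..})"
proof -
  have "(\<lambda>t. b (1 / t)) \<in> borel_measurable (lebesgue_on {0<..})"
    using assms by (simp add: SV1_def SV0_def SV_def)
  from measurable_compose[OF measurable_inverse_pos this] show ?thesis by simp
qed

lemma SV1_pos: "b \<in> SV1 p \<Longrightarrow> 0 < u \<Longrightarrow> 0 < b u"
proof -
  assume "b \<in> SV1 p" "0 < u"
  then have "\<forall>t>0. 0 < b (1 / t)" by (simp add: SV1_def SV0_def SV_def)
  from spec[OF this, of "1 / u"] show ?thesis using \<open>0 < u\<close> by simp
qed

lemma weight_measurable:
  assumes "b \<in> SV1 p"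
  shows "weight p b \<in> borel_measurable (lebesgue_on {0<..})"
proof -
  have [measurable]: "b \<in> borel_measurable (lebesgue_on {0<..})" by (rule SV1_measurable[OF assms])
  show ?thesis unfolding weight_def by measurable
qed

text \<open>The exponent \<open>1/2\<close> is a choice: any exponent between \<open>0\<close> and \<open>1\<close> gives the tail estimate below.
  Substituting \<open>1/t\<close> turns the non-decreasing function equivalent to \<open>t\<^sup>1\<^sup>/\<^sup>2 b(1/t)\<close> into a non-increasing
  one.\<close>
lemma SV1_antimono_equivalent:
  assumes "b \<in> SV1 p"
  obtains h C where "C > 0" "antimono_on {0<..} h" "\<And>u. 0 < u \<Longrightarrow> 0 < h u"
    "\<And>u. 0 < u \<Longrightarrow> u powr (- (1/2)) * b u \<le> C * h u"
    "\<And>u. 0 < u \<Longrightarrow> h u \<le> C * (u powr (- (1/2)) * b u)"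
proof -
  have "(\<lambda>t. b (1 / t)) \<in> SV" using assms by (simp add: SV1_def SV0_def)
  then have "\<exists>g. (\<forall>t>0. g t > 0) \<and> mono_on {0<..} g \<and>
     approx_on {0<..} (\<lambda>t. ennreal (t powr (1/2) * b (1 / t))) (\<lambda>t. ennreal (g t))"
    unfolding SV_def by (auto dest!: spec[of _ "1/2 :: real"])
  then obtain g c d where g: "\<And>t. 0 < t \<Longrightarrow> 0 < g t" "mono_on {0<..} g" and c: "c > 0" "d > 0"
    and 1: "\<And>t. 0 < t \<Longrightarrow> ennreal (t powr (1/2) * b (1 / t)) \<le> ennreal c * ennreal (g t)"
    and 2: "\<And>t. 0 < t \<Longrightarrow> ennreal (g t) \<le> ennreal d * ennreal (t powr (1/2) * b (1 / t))"
    unfolding approx_on_def lesssim_on_def by (elim exE conjE) (simp only: greaterThan_iff Ball_def, blast)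
  have pw: "(1 / u) powr (1/2) = u powr (- (1/2))" if "0 < u" for u :: real
    using that by (simp add: powr_divide powr_minus_divide)
  have bp: "0 < b u" if "0 < u" for u using SV1_pos[OF assms that] .
  show ?thesis
  proof (rule that[of "max c d" "\<lambda>u. g (1 / u)"])
    show "antimono_on {0<..} (\<lambda>u. g (1 / u))"
      using g(2) by (auto simp: monotone_on_def frac_le)
    fix u :: real assume u: "0 < u"
    have gp: "0 < g (1 / u)" using g(1) u by simp
    have "u powr (- (1/2)) * b u \<le> c * g (1 / u)"
      using 1[of "1 / u"] u c gp by (simp add: pw ennreal_mult[symmetric] ennreal_le_iff)
    also have "\<dots> \<le> max c d * g (1 / u)" using gp by (intro mult_right_mono) auto
    finally show "u powr (- (1/2)) * b u \<le> max c d * g (1 / u)" .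
    have "g (1 / u) \<le> d * (u powr (- (1/2)) * b u)"
      using 2[of "1 / u"] u c bp[OF u] by (simp add: pw ennreal_mult[symmetric] ennreal_le_iff)
    also have "\<dots> \<le> max c d * (u powr (- (1/2)) * b u)" using bp[OF u] by (intro mult_right_mono) auto
    finally show "g (1 / u) \<le> max c d * (u powr (- (1/2)) * b u)" .
  qed (use c g in auto)
qed

text \<open>Let \<open>h\<close> be the non-increasing function equivalent to \<open>u\<^sup>-\<^sup>1\<^sup>/\<^sup>2 b(u)\<close>. On \<open>(t,\<infinity>)\<close> it is at most \<open>h(t)\<close>
  and on \<open>(0,t)\<close> at least \<open>h(t)\<close>, so both quasi-norms are compared with \<open>h(t)\<close> times a
  quasi-norm of a power, and the powers of \<open>t\<close> combine to \<open>1/t\<close>.\<close>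
lemma weight_tail_initial:
  assumes p: "0 < p" and b: "b \<in> SV1 p"
  obtains c where "c > 0"
    "\<And>t. 0 < t \<Longrightarrow> Lq_norm p {t<..} (\<lambda>u. ennreal (1 / u) * weight p b u) < \<infinity>"
    "\<And>t. 0 < t \<Longrightarrow> 0 < Lq_norm p {0<..<t} (weight p b)"
    "\<And>t. 0 < t \<Longrightarrow> Lq_norm p {t<..} (\<lambda>u. ennreal (1 / u) * weight p b u)
       \<le> ennreal c * (ennreal (1 / t) * Lq_norm p {0<..<t} (weight p b))"
proof -
  obtain h C where C: "C > 0" and h: "antimono_on {0<..} h" "\<And>u. 0 < u \<Longrightarrow> 0 < h u"
    and up: "\<And>u. 0 < u \<Longrightarrow> u powr (- (1/2)) * b u \<le> C * h u"
    and lo: "\<And>u. 0 < u \<Longrightarrow> h u \<le> C * (u powr (- (1/2)) * b u)"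
    by (rule SV1_antimono_equivalent[OF b]) (rule that)
  obtain k1 where k1: "k1 > 0" "\<And>t. 0 < t \<Longrightarrow>
      Lq_norm p {t<..} (\<lambda>u. ennreal (u powr (- (1/2) - rec_exp p))) \<le> ennreal (k1 * t powr (- (1/2)))"
    using Lq_norm_powr_tail[OF p] by blast
  obtain k2 where k2: "k2 > 0" "\<And>t. 0 < t \<Longrightarrow>
      ennreal (k2 * t powr (1/2)) \<le> Lq_norm p {0<..<t} (\<lambda>u. ennreal (u powr (1/2 - rec_exp p)))"
    using Lq_norm_powr_initial[OF p] by blast
  have bp: "0 < b u" if "0 < u" for u using SV1_pos[OF b that] .
  have [measurable]: "weight p b \<in> borel_measurable (lebesgue_on {0<..})"
    by (rule weight_measurable[OF b])
  have Wm: "(\<lambda>u. ennreal (1 / u) * weight p b u) \<in> borel_measurable (lebesgue_on {0<..})"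
    by measurable
  have tail: "Lq_norm p {t<..} (\<lambda>u. ennreal (1 / u) * weight p b u)
      \<le> ennreal (C * h t * (k1 * t powr (- (1/2))))" if t: "0 < t" for t
  proof -
    have "Lq_norm p {t<..} (\<lambda>u. ennreal (1 / u) * weight p b u)
        \<le> Lq_norm p {t<..} (\<lambda>u. ennreal (C * h t) * ennreal (u powr (- (1/2) - rec_exp p)))"
    proof (rule Lq_norm_mono[OF p])
      show "(\<lambda>u. ennreal (1 / u) * weight p b u) \<in> borel_measurable (lebesgue_on {t<..})"
        by (rule measurable_restrict_mono[OF Wm]) (use t in auto)
      fix u assume "u \<in> {t<..}"
      then have u: "0 < u" "t \<le> u" using t by auto
      have "1 / u * (u powr (- rec_exp p) * b u) = u powr (- (1/2)) * b u * u powr (- (1/2) - rec_exp p)"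
      proof -
        have "u powr (- (1/2)) * u powr (- (1/2) - rec_exp p) = u powr (-1 - rec_exp p)"
          by (simp flip: powr_add)
        also have "\<dots> = 1 / u * u powr (- rec_exp p)"
          using u by (simp add: powr_diff powr_minus_divide field_simps)
        finally show ?thesis by (simp add: mult_ac)
      qed
      also have "\<dots> \<le> C * h u * u powr (- (1/2) - rec_exp p)"
        using up[OF u(1)] by (intro mult_right_mono) auto
      also have "\<dots> \<le> C * h t * u powr (- (1/2) - rec_exp p)"
        using monotone_onD[OF h(1), of t u] C u t by (intro mult_right_mono mult_left_mono) auto
      finally show "ennreal (1 / u) * weight p b u \<le> ennreal (C * h t) * ennreal (u powr (- (1/2) - rec_exp p))"
        using C h(2)[OF t] bp[OF u(1)] u unfolding weight_def
        by (subst (1 2) ennreal_mult[symmetric]) (auto intro!: ennreal_leI)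
    qed
    also have "\<dots> = ennreal (C * h t) * Lq_norm p {t<..} (\<lambda>u. ennreal (u powr (- (1/2) - rec_exp p)))"
      using C h(2)[OF t] by (intro Lq_norm_cmult[OF p]) auto
    also have "\<dots> \<le> ennreal (C * h t) * ennreal (k1 * t powr (- (1/2)))"
      by (intro mult_left_mono k1 t) simp
    also have "\<dots> = ennreal (C * h t * (k1 * t powr (- (1/2))))"
      using C h(2)[OF t] k1(1) by (simp add: ennreal_mult)
    finally show ?thesis .
  qed
  have init: "ennreal (h t / C * (k2 * t powr (1/2))) \<le> Lq_norm p {0<..<t} (weight p b)"
    if t: "0 < t" for t
  proof -
    have "ennreal (h t / C * (k2 * t powr (1/2))) = ennreal (h t / C) * ennreal (k2 * t powr (1/2))"
      using C h(2)[OF t] k2(1) by (intro ennreal_mult) auto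
    also have "\<dots> \<le> ennreal (h t / C) * Lq_norm p {0<..<t} (\<lambda>u. ennreal (u powr (1/2 - rec_exp p)))"
      by (intro mult_left_mono k2 t) simp
    also have "\<dots> = Lq_norm p {0<..<t} (\<lambda>u. ennreal (h t / C) * ennreal (u powr (1/2 - rec_exp p)))"
      using C h(2)[OF t] by (intro Lq_norm_cmult[OF p, symmetric]) auto
    also have "\<dots> \<le> Lq_norm p {0<..<t} (weight p b)"
    proof (rule Lq_norm_mono[OF p])
      fix u assume "u \<in> {0<..<t}"
      then have u: "0 < u" "u < t" by auto
      have "h t / C \<le> h u / C"
        using monotone_onD[OF h(1), of u t] C u by (intro divide_right_mono) auto
      also have "\<dots> \<le> u powr (- (1/2)) * b u"
        using lo[OF u(1)] C by (simp add: field_simps)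
      finally have "h t / C * u powr (1/2 - rec_exp p) \<le> u powr (- (1/2)) * b u * u powr (1/2 - rec_exp p)"
        by (rule mult_right_mono) simp
      also have "\<dots> = u powr (- rec_exp p) * b u"
      proof -
        have "u powr (- (1/2)) * u powr (1/2 - rec_exp p) = u powr (- rec_exp p)"
          by (simp flip: powr_add)
        then show ?thesis by (simp add: mult_ac flip: mult.assoc)
      qed
      finally show "ennreal (h t / C) * ennreal (u powr (1/2 - rec_exp p)) \<le> weight p b u"
        using C h(2)[OF t] unfolding weight_def
        by (subst ennreal_mult[symmetric]) (auto intro!: ennreal_leI)
    qed auto
    finally show ?thesis .
  qed
  show ?thesis
  proof (rule that[of "C * C * k1 / k2"])
    show "C * C * k1 / k2 > 0" using C k1 k2 by simp
    fix t :: real assume t: "0 < t"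
    show "Lq_norm p {t<..} (\<lambda>u. ennreal (1 / u) * weight p b u) < \<infinity>"
      using tail[OF t] by (rule order_le_less_trans) simp
    have "0 < ennreal (h t / C * (k2 * t powr (1/2)))" using C k2 t h(2)[OF t] by simp
    then show "0 < Lq_norm p {0<..<t} (weight p b)"
      using init[OF t] by (rule order_less_le_trans)
    note tail[OF t]
    also have "C * h t * (k1 * t powr (- (1/2))) = C * C * k1 / k2 * (1 / t * (h t / C * (k2 * t powr (1/2))))"
    proof -
      have "t powr (- (1/2)) = t powr (1/2) / t"
        using t powr_diff[of t "1/2" 1] by simp
      then show ?thesis using C k2 by (simp add: field_simps)
    qed
    also have "ennreal \<dots> = ennreal (C * C * k1 / k2) * (ennreal (1 / t) * ennreal (h t / C * (k2 * t powr (1/2))))"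
      using C k1 k2 t h(2)[OF t] by (simp add: ennreal_mult del: times_divide_eq_left times_divide_eq_right)
    also have "\<dots> \<le> ennreal (C * C * k1 / k2) * (ennreal (1 / t) * Lq_norm p {0<..<t} (weight p b))"
      by (intro mult_left_mono init t) auto
    finally show "Lq_norm p {t<..} (\<lambda>u. ennreal (1 / u) * weight p b u)
       \<le> ennreal (C * C * k1 / k2) * (ennreal (1 / t) * Lq_norm p {0<..<t} (weight p b))" .
  qed
qed

text \<open>The integrability of \<open>b(1/t)\<close> at infinity is transported by the substitution \<open>v = 1/u\<close>, under
  which \<open>du/u\<close> is invariant. For \<open>p = \<infinity>\<close> the exceptional null set is transported instead.\<close>
lemma weight_finite_unit:
  assumes p: "0 < p" and b: "b \<in> SV1 p"
  shows "Lq_norm p {0<..<1} (weight p b) < \<infinity>"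
proof (cases "p = \<infinity>")
  case True
  define m where "m = Lq_norm p {1<..} (weight p (\<lambda>u. b (1 / u)))"
  have m: "m < \<infinity>" using b by (simp add: SV1_def SV0_def m_def weight_def)
  have "AE u in lebesgue_on {1<..}. weight p (\<lambda>u. b (1 / u)) u \<le> m"
    using esssup_AE[where M="lebesgue_on {1<..}" and f="weight p (\<lambda>u. b (1 / u))"] True
    by (simp add: Lq_norm_top m_def)
  then have "AE u in lebesgue_on {1<..}. ennreal (b (1 / u)) \<le> m"
    using True by (auto simp: weight_def AE_restrict_space_iff elim!: eventually_mono)
  then have "AE u in lebesgue. 1 < u \<longrightarrow> ennreal (b (1 / u)) \<le> m"
    by (subst (asm) AE_restrict_space_iff) auto
  then obtain N where N: "N \<in> null_sets lebesgue" "{u. 1 < u \<and> \<not> ennreal (b (1 / u)) \<le> m} \<subseteq> N"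
    unfolding eventually_ae_filter by auto
  define N' where "N' = {u. 1 < u \<and> \<not> ennreal (b (1 / u)) \<le> m}"
  have "negligible N'" using N unfolding N'_def by (meson negligible_iff_null_sets negligible_subset)
  then have neg: "negligible ((\<lambda>u. 1 / u) ` N')"
    by (intro negligible_differentiable_image_negligible inverse_differentiable_on)
      (auto simp: N'_def)
  have "AE v in lebesgue_on {0<..<1}. weight p b v \<le> m"
  proof (subst AE_restrict_space_iff)
    show "AE v in lebesgue. v \<in> {0<..<1} \<longrightarrow> weight p b v \<le> m"
    proof (rule AE_I')
      show "(\<lambda>u. 1 / u) ` N' \<in> null_sets lebesgue" using neg by (simp add: negligible_iff_null_sets)
      show "{v \<in> space lebesgue. \<not> (v \<in> {0<..<1} \<longrightarrow> weight p b v \<le> m)} \<subseteq> (\<lambda>u. 1 / u) ` N'"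
      proof
        fix v assume "v \<in> {v \<in> space lebesgue. \<not> (v \<in> {0<..<1} \<longrightarrow> weight p b v \<le> m)}"
        then have "1 / v \<in> N'" using True by (auto simp: N'_def weight_def)
        then have "1 / (1 / v) \<in> (\<lambda>u. 1 / u) ` N'" by (rule imageI)
        then show "v \<in> (\<lambda>u. 1 / u) ` N'" by simp
      qed
    qed
  qed simp
  moreover have "weight p b \<in> borel_measurable (lebesgue_on {0<..<1})"
    by (rule measurable_restrict_mono[OF weight_measurable[OF b]]) auto
  ultimately have "Lq_norm p {0<..<1} (weight p b) \<le> m" using True by (auto simp: Lq_norm_top)
  then show ?thesis using m by (rule order_le_less_trans)
next
  case False
  then have *: "0 < p" "p < \<infinity>" using p by (auto simp: less_top)
  define q where "q = enn2real p"
  have q: "0 < q" "rec_exp p = 1 / q" using rec_exp_finite[OF *] by (auto simp: q_def)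
  have bp: "0 < b u" if "0 < u" for u using SV1_pos[OF b that] .
  have wq: "epowr (weight p c u) q = ennreal (c u powr q / u)" if "0 < u" "0 < c u" for c u
    using that q by (simp add: weight_def epowr_ennreal powr_mult powr_powr powr_minus_divide powr_divide)
  \<comment> \<open>The integrand in the variable of the image interval; the Jacobian is \<open>1/u\<^sup>2\<close>.\<close>
  define F where "F v = b v powr q / v" for v
  have im: "(\<lambda>u. 1 / u) ` {1<..} = {0::real<..<1}"
  proof -
    have "v = 1 / (1 / v)" "1 < 1 / v" if "0 < v" "v < 1" for v :: real using that by auto
    then show ?thesis by (auto simp: image_iff intro!: bexI[where x="1 / _"])
  qed
  have "(\<lambda>u. b (1 / u)) \<in> borel_measurable (lebesgue_on {0<..})"
    using b by (simp add: SV1_def SV0_def SV_def)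
  then have [measurable]: "(\<lambda>u. b (1 / u)) \<in> borel_measurable (lebesgue_on {1<..})"
    by (rule measurable_restrict_mono) auto
  have "Lq_norm p {1<..} (weight p (\<lambda>u. b (1 / u))) < \<infinity>"
    using b by (simp add: SV1_def SV0_def weight_def)
  then have "epowr (Lq_norm p {1<..} (weight p (\<lambda>u. b (1 / u)))) q < \<infinity>"
    by (auto simp: epowr_def)
  also have "epowr (Lq_norm p {1<..} (weight p (\<lambda>u. b (1 / u)))) q
      = (\<integral>\<^sup>+u. ennreal (b (1 / u) powr q / u) \<partial>lebesgue_on {1<..})"
    unfolding epowr_Lq_norm[OF *, folded q_def] using bp
    by (intro nn_integral_cong wq) auto
  finally have fin: "(\<integral>\<^sup>+u. ennreal (b (1 / u) powr q / u) \<partial>lebesgue_on {1<..}) < \<infinity>" .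
  have nrm: "(\<integral>\<^sup>+u. ennreal (norm (b (1 / u) powr q / u)) \<partial>lebesgue_on {1<..})
      = (\<integral>\<^sup>+u. ennreal (b (1 / u) powr q / u) \<partial>lebesgue_on {1<..})"
    by (intro nn_integral_cong) auto
  have "integrable (lebesgue_on {1<..}) (\<lambda>u. b (1 / u) powr q / u)"
    unfolding integrable_iff_bounded nrm using fin by (intro conjI) measurable
  then have "(\<lambda>u. b (1 / u) powr q / u) absolutely_integrable_on {1<..}"
    by (subst (asm) integrable_restrict_space) (auto simp: set_integrable_def)
  moreover have "\<bar>- 1 / u\<^sup>2\<bar> * F (1 / u) = b (1 / u) powr q / u" if "u \<in> {1<..}" for u
    using that by (simp add: F_def power2_eq_square)
  ultimately have "(\<lambda>u. \<bar>- 1 / u\<^sup>2\<bar> * F (1 / u)) absolutely_integrable_on {1<..}"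
    by (subst set_integrable_cong[OF refl refl]) auto
  then have "F absolutely_integrable_on (\<lambda>u. 1 / u) ` {1<..}"
    by (rule has_absolute_integral_change_of_variables_1'[THEN iffD1, THEN conjunct1, rotated 3, OF conjI[OF _ refl]])
      (auto intro!: derivative_eq_intros inj_onI simp: power2_eq_square)
  then have "integrable (lebesgue_on {0<..<1}) F"
    unfolding im by (subst integrable_restrict_space) (auto simp: set_integrable_def)
  then have "(\<integral>\<^sup>+v. ennreal (norm (F v)) \<partial>lebesgue_on {0<..<1}) < \<infinity>"
    unfolding integrable_iff_bounded by blast
  also have "(\<integral>\<^sup>+v. ennreal (norm (F v)) \<partial>lebesgue_on {0<..<1})
     = epowr (Lq_norm p {0<..<1} (weight p b)) q"
    unfolding epowr_Lq_norm[OF *, folded q_def]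
    by (intro nn_integral_cong) (use bp in \<open>auto simp: wq F_def\<close>)
  finally show ?thesis by (auto simp: epowr_def less_top[symmetric] split: if_splits)
qed

text \<open>Away from the origin \<open>w(u) \<le> T w(u)/u\<close> for \<open>u < T\<close>, so the tail estimate covers what the unit
  interval leaves open.\<close>
lemma weight_finite:
  assumes p: "0 < p" and b: "b \<in> SV1 p" and t: "0 < t"
  shows "Lq_norm p {0<..<t} (weight p b) < \<infinity>"
proof -
  \<comment> \<open>The two pieces \<open>(0,1)\<close> and \<open>(1/2,T)\<close> overlap, so that no end point is lost.\<close>
  define T where "T = max 2 t"
  note W = weight_measurable[OF b]
  have W': "(\<lambda>u. ennreal (1 / u) * weight p b u) \<in> borel_measurable (lebesgue_on {0<..})"
    using W by measurable
  have "Lq_norm p {1/2<..<T} (weight p b)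
      \<le> Lq_norm p {1/2<..<T} (\<lambda>u. ennreal T * (ennreal (1 / u) * weight p b u))"
  proof (rule Lq_norm_mono[OF p])
    fix u assume u: "u \<in> {1/2<..<T}"
    have "1 * weight p b u \<le> ennreal (T * (1 / u)) * weight p b u"
      using u by (intro mult_right_mono) (auto simp: ennreal_ge_1)
    also have "\<dots> = ennreal T * (ennreal (1 / u) * weight p b u)"
      using u by (subst ennreal_mult) (auto simp: T_def mult.assoc)
    finally show "weight p b u \<le> ennreal T * (ennreal (1 / u) * weight p b u)" by simp
  qed (rule measurable_restrict_mono[OF W], auto)
  also have "\<dots> = ennreal T * Lq_norm p {1/2<..<T} (\<lambda>u. ennreal (1 / u) * weight p b u)"
    by (intro Lq_norm_cmult[OF p] measurable_restrict_mono[OF W']) (auto simp: T_def)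
  also have "\<dots> \<le> ennreal T * Lq_norm p {1/2<..} (\<lambda>u. ennreal (1 / u) * weight p b u)"
    by (intro mult_left_mono Lq_norm_mono_set[OF p] measurable_restrict_mono[OF W']) auto
  also have "\<dots> < \<infinity>"
    using weight_tail_initial[OF p b] by (metis ennreal_mult_less_top ennreal_less_top half_gt_zero_iff infinity_ennreal_def zero_less_one)
  finally have fin: "Lq_norm p {1/2<..<T} (weight p b) < \<infinity>" .
  have "Lq_norm p {0<..<t} (weight p b) \<le> Lq_norm p {0<..<T} (weight p b)"
    by (intro Lq_norm_mono_set[OF p] measurable_restrict_mono[OF W]) (auto simp: T_def)
  also have "\<dots> \<le> ennreal (triangle_const p) * (Lq_norm p {0<..<1} (weight p b) + Lq_norm p {1/2<..<T} (weight p b))"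
    by (intro Lq_norm_split[OF p] measurable_restrict_mono[OF W] AE_I2) (auto simp: T_def)
  also have "\<dots> < \<infinity>" using fin weight_finite_unit[OF p b] by (auto simp: ennreal_mult_less_top)
  finally show ?thesis .
qed

section \<open>The K-functional\<close>

lemma K_functional_le:
  assumes "f0 \<in> carrier A0" "f1 \<in> carrier A1"
  shows "K_functional t (f0 + f1) A0 A1 \<le> ennreal (qnorm A0 f0) + t * ennreal (qnorm A1 f1)"
  unfolding K_functional_def using assms
  by (intro INF_lower2[of "(f0, f1)"]) auto

lemma K_functional_greatest:
  assumes "\<And>f0 f1. f0 \<in> carrier A0 \<Longrightarrow> f1 \<in> carrier A1 \<Longrightarrow> f = f0 + f1 \<Longrightarrow>
    x \<le> ennreal (qnorm A0 f0) + t * ennreal (qnorm A1 f1)"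
  shows "x \<le> K_functional t f A0 A1"
  unfolding K_functional_def using assms by (auto intro!: INF_greatest)

lemma K_functional_near_optimal:
  assumes "K_functional t f A0 A1 < a"
  obtains f0 f1 where "f0 \<in> carrier A0" "f1 \<in> carrier A1" "f = f0 + f1"
    "ennreal (qnorm A0 f0) + t * ennreal (qnorm A1 f1) < a"
  using assms unfolding K_functional_def INF_less_iff by auto

lemma K_functional_finite:
  assumes "f \<in> carrier A0 + carrier A1" "t < \<infinity>"
  shows "K_functional t f A0 A1 < \<infinity>"
proof -
  obtain f0 f1 where "f0 \<in> carrier A0" "f1 \<in> carrier A1" "f = f0 + f1"
    using assms by (auto elim: set_plus_elim)
  then have "K_functional t f A0 A1 \<le> ennreal (qnorm A0 f0) + t * ennreal (qnorm A1 f1)"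
    using K_functional_le by metis
  also have "\<dots> < \<infinity>" using assms by (auto simp: ennreal_mult_less_top)
  finally show ?thesis .
qed

lemma K_functional_mono: "s \<le> t \<Longrightarrow> K_functional s f A0 A1 \<le> K_functional t f A0 A1"
  unfolding K_functional_def by (intro INF_mono') (auto intro!: add_left_mono mult_right_mono)

definition K_quotient :: "'a::real_vector qspace \<Rightarrow> 'a qspace \<Rightarrow> 'a \<Rightarrow> real \<Rightarrow> ennreal" where
  "K_quotient A0 A1 f u = ennreal (1 / u) * K_functional (ennreal u) f A0 A1"

text \<open>Scaling a decomposition: \<open>(s/t) (x + t y) \<le> x + s y\<close> for \<open>s \<le> t\<close>.\<close>
lemma K_quotient_antimono: "antimono_on {0<..} (K_quotient A0 A1 f)"
proof (rule monotone_onI)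
  fix s t :: real assume "s \<in> {0<..}" "t \<in> {0<..}" "s \<le> t"
  then have st: "0 < s" "0 < t" "s \<le> t" by auto
  have "ennreal (s / t) * K_functional (ennreal t) f A0 A1 \<le> K_functional (ennreal s) f A0 A1"
  proof (rule K_functional_greatest)
    fix f0 f1 assume f: "f0 \<in> carrier A0" "f1 \<in> carrier A1" "f = f0 + f1"
    have "ennreal (s / t) * K_functional (ennreal t) f A0 A1
        \<le> ennreal (s / t) * (ennreal (qnorm A0 f0) + ennreal t * ennreal (qnorm A1 f1))"
      unfolding f(3) by (intro mult_left_mono K_functional_le f) simp
    also have "\<dots> = ennreal (s / t) * ennreal (qnorm A0 f0) + ennreal s * ennreal (qnorm A1 f1)"
      using st by (simp add: distrib_left ennreal_mult[symmetric] flip: mult.assoc)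
    also have "\<dots> \<le> 1 * ennreal (qnorm A0 f0) + ennreal s * ennreal (qnorm A1 f1)"
      using st by (intro add_right_mono mult_right_mono) auto
    finally show "ennreal (s / t) * K_functional (ennreal t) f A0 A1
        \<le> ennreal (qnorm A0 f0) + ennreal s * ennreal (qnorm A1 f1)" by simp
  qed
  then have "ennreal (1 / s) * (ennreal (s / t) * K_functional (ennreal t) f A0 A1)
      \<le> ennreal (1 / s) * K_functional (ennreal s) f A0 A1"
    by (rule mult_left_mono) simp
  then show "K_quotient A0 A1 f t \<le> K_quotient A0 A1 f s"
    unfolding K_quotient_def mult.assoc[symmetric] using st by (subst (asm) ennreal_mult[symmetric]) auto
qed

lemma K_quotient_doubling:
  assumes "0 < u" "u < r" "r < 2 * u"
  shows "K_quotient A0 A1 f u \<le> 2 * K_quotient A0 A1 f r"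
proof -
  have "K_quotient A0 A1 f u \<le> ennreal (2 * (1 / r)) * K_functional (ennreal r) f A0 A1"
    unfolding K_quotient_def using assms
    by (intro mult_mono ennreal_leI K_functional_mono) (auto simp: field_simps)
  also have "\<dots> = 2 * K_quotient A0 A1 f r"
  proof -
    have "ennreal (2 * (1 / r)) = 2 * ennreal (1 / r)" using assms by (subst ennreal_mult) auto
    then show ?thesis by (simp only: K_quotient_def mult.assoc)
  qed
  finally show ?thesis .
qed

lemma K_quotient_finite:
  "f \<in> carrier A0 + carrier A1 \<Longrightarrow> K_quotient A0 A1 f u < \<infinity>"
  using K_functional_finite[of f A0 A1 "ennreal u"]
  by (auto simp: K_quotient_def ennreal_mult_less_top)

lemma quasi_normed_space_subspace: "quasi_normed_space A \<Longrightarrow> subspace (carrier A)"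
  by (simp add: quasi_normed_space_def)

lemma qnorm_nonneg: "quasi_normed_space A \<Longrightarrow> x \<in> carrier A \<Longrightarrow> 0 \<le> qnorm A x"
  by (simp add: quasi_normed_space_def)

lemma qnorm_zero: "quasi_normed_space A \<Longrightarrow> qnorm A 0 = 0"
  by (simp add: quasi_normed_space_def subspace_0)

lemma qnorm_minus:
  assumes "quasi_normed_space A" "x \<in> carrier A"
  shows "qnorm A (- x) = qnorm A x"
proof -
  have "qnorm A ((- 1) *\<^sub>R x) = \<bar>- 1\<bar> * qnorm A x"
    using assms unfolding quasi_normed_space_def by metis
  then show ?thesis by simp
qed

lemma quasi_normed_space_triangle:
  assumes "quasi_normed_space A"
  obtains C where "1 \<le> C" "\<And>x y. x \<in> carrier A \<Longrightarrow> y \<in> carrier A \<Longrightarrow>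
    qnorm A (x + y) \<le> C * (qnorm A x + qnorm A y)"
proof -
  have "\<exists>C\<ge>1. \<forall>x\<in>carrier A. \<forall>y\<in>carrier A. qnorm A (x + y) \<le> C * (qnorm A x + qnorm A y)"
    using assms by (simp add: quasi_normed_space_def)
  then show ?thesis by (elim exE conjE) (rule that, assumption, blast)
qed

text \<open>The infimum need not be attained, so decompositions within \<open>d\<close> of it are added; the error
  \<open>2 C d\<close> is the prescribed \<open>e\<close>.\<close>
lemma K_functional_triangle:
  assumes "quasi_normed_space A0" "quasi_normed_space A1"
  obtains C where "1 \<le> C" "\<And>f g t. K_functional t (f + g) A0 A1 \<le>
    ennreal C * (K_functional t f A0 A1 + K_functional t g A0 A1)"
proof -
  obtain C0 where C0: "1 \<le> C0" "\<And>x y. x \<in> carrier A0 \<Longrightarrow> y \<in> carrier A0 \<Longrightarrow>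
      qnorm A0 (x + y) \<le> C0 * (qnorm A0 x + qnorm A0 y)"
    by (rule quasi_normed_space_triangle[OF assms(1)]) (rule that)
  obtain C1 where C1: "1 \<le> C1" "\<And>x y. x \<in> carrier A1 \<Longrightarrow> y \<in> carrier A1 \<Longrightarrow>
      qnorm A1 (x + y) \<le> C1 * (qnorm A1 x + qnorm A1 y)"
    by (rule quasi_normed_space_triangle[OF assms(2)]) (rule that)
  have nn: "x \<in> carrier A0 \<Longrightarrow> 0 \<le> qnorm A0 x" "x \<in> carrier A1 \<Longrightarrow> 0 \<le> qnorm A1 x" for x
    using assms by (auto intro: qnorm_nonneg)
  have add: "x \<in> carrier A0 \<Longrightarrow> y \<in> carrier A0 \<Longrightarrow> x + y \<in> carrier A0"
    "x \<in> carrier A1 \<Longrightarrow> y \<in> carrier A1 \<Longrightarrow> x + y \<in> carrier A1" for x y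
    using assms by (auto intro: subspace_add quasi_normed_space_subspace)
  define C where "C = max C0 C1"
  have step: "ennreal q \<le> ennreal C * (ennreal a + ennreal b)"
    if "q \<le> C' * (a + b)" "C' \<le> C" "0 \<le> a" "0 \<le> b" "0 \<le> C" for q a b C' :: real
  proof -
    have "q \<le> C * (a + b)" using that mult_right_mono[of C' C "a + b"] by linarith
    then have "ennreal q \<le> ennreal (C * (a + b))" by (rule ennreal_leI)
    then show ?thesis using that by (simp add: ennreal_mult)
  qed
  have C: "1 \<le> C" "C0 \<le> C" "C1 \<le> C" using C0(1) by (auto simp: C_def)
  have dec: "K_functional t (f + g) A0 A1 \<le> ennreal C *
     ((ennreal (qnorm A0 f0) + t * ennreal (qnorm A1 f1)) + (ennreal (qnorm A0 g0) + t * ennreal (qnorm A1 g1)))"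
    if f: "f0 \<in> carrier A0" "f1 \<in> carrier A1" "f = f0 + f1"
      and g: "g0 \<in> carrier A0" "g1 \<in> carrier A1" "g = g0 + g1" for t f g f0 f1 g0 g1
  proof -
    have "f + g = (f0 + g0) + (f1 + g1)" using f g by simp
    then have "K_functional t (f + g) A0 A1 \<le> ennreal (qnorm A0 (f0 + g0)) + t * ennreal (qnorm A1 (f1 + g1))"
      using K_functional_le[OF add(1)[OF f(1) g(1)] add(2)[OF f(2) g(2)]] by simp
    also have "\<dots> \<le> ennreal C * (ennreal (qnorm A0 f0) + ennreal (qnorm A0 g0))
        + t * (ennreal C * (ennreal (qnorm A1 f1) + ennreal (qnorm A1 g1)))"
      using f g nn C C0 C1
      by (intro add_mono mult_left_mono step[of _ C0] step[of _ C1]) auto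
    also have "\<dots> = ennreal C * ((ennreal (qnorm A0 f0) + t * ennreal (qnorm A1 f1))
        + (ennreal (qnorm A0 g0) + t * ennreal (qnorm A1 g1)))"
      by (simp add: algebra_simps)
    finally show ?thesis .
  qed
  show ?thesis
  proof (rule that[of C])
    fix t f g
    let ?K = "\<lambda>f. K_functional t f A0 A1"
    show "?K (f + g) \<le> ennreal C * (?K f + ?K g)"
    proof (rule ennreal_le_epsilon)
      fix e :: real assume fin: "ennreal C * (?K f + ?K g) < top" and e: "0 < e"
      define d where "d = e / (2 * C)"
      have d: "0 < d" using e C by (simp add: d_def)
      have "?K f < top" "?K g < top"
        using fin C by (auto simp: ennreal_mult_less_top)
      then have "?K f < ?K f + ennreal d" "?K g < ?K g + ennreal d"
        using d by (auto simp: ennreal_add_left_cancel_less less_top)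
      then obtain f0 f1 g0 g1 where
        f: "f0 \<in> carrier A0" "f1 \<in> carrier A1" "f = f0 + f1"
          "ennreal (qnorm A0 f0) + t * ennreal (qnorm A1 f1) < ?K f + ennreal d"
        and g: "g0 \<in> carrier A0" "g1 \<in> carrier A1" "g = g0 + g1"
          "ennreal (qnorm A0 g0) + t * ennreal (qnorm A1 g1) < ?K g + ennreal d"
        by (metis K_functional_near_optimal)
      have "?K (f + g) \<le> ennreal C * ((?K f + ennreal d) + (?K g + ennreal d))"
        using add_mono[OF less_imp_le[OF f(4)] less_imp_le[OF g(4)]]
        by (intro order_trans[OF dec[OF f(1-3) g(1-3)]] mult_left_mono) auto
      also have "\<dots> = ennreal C * (?K f + ?K g) + ennreal C * (ennreal d + ennreal d)"
        by (simp add: algebra_simps)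
      also have "ennreal C * (ennreal d + ennreal d) = ennreal e"
      proof -
        have "ennreal C * (ennreal d + ennreal d) = ennreal (C * (d + d))"
          using C d by (subst ennreal_mult, simp, simp, subst ennreal_plus, simp_all)
        also have "C * (d + d) = e" using C by (simp add: d_def field_simps)
        finally show ?thesis .
      qed
      finally show "?K (f + g) \<le> ennreal C * (?K f + ?K g) + ennreal e" .
    qed
  qed (rule C(1))
qed


section \<open>The Holmstedt formula\<close>

lemma integrand_eq:
  assumes "0 < u"
  shows "ennreal (u powr (- 1 - rec_exp p) * b u) * K_functional (ennreal u) f A0 A1
    = K_quotient A0 A1 f u * weight p b u"
proof -
  have "u powr (- 1 - rec_exp p) * b u = 1 / u * (u powr (- rec_exp p) * b u)"
    using assms by (simp add: powr_diff powr_minus_divide field_simps)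
  then have "ennreal (u powr (- 1 - rec_exp p) * b u) = ennreal (1 / u) * weight p b u"
    using assms by (simp only: weight_def) (rule ennreal_mult', simp)
  then show ?thesis by (simp only: K_quotient_def mult_ac)
qed

lemma interp_norm_eq:
  "interp_norm A0 A1 1 p b f = Lq_norm p {0<..} (\<lambda>u. K_quotient A0 A1 f u * weight p b u)"
  unfolding interp_norm_def by (intro Lq_norm_cong) (simp add: integrand_eq)

lemma I1_eq:
  "I1 A0 A1 p b t f = Lq_norm p {0<..<t} (\<lambda>u. K_quotient A0 A1 f u * weight p b u)"
  unfolding I1_def by (intro Lq_norm_cong) (simp add: integrand_eq)

lemma J1_eq:
  "0 < t \<Longrightarrow> J1 A0 A1 p b t f = Lq_norm p {t<..} (\<lambda>u. K_quotient A0 A1 f u * weight p b u)"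
  unfolding J1_def by (intro Lq_norm_cong) (simp add: integrand_eq)

lemma eta_eq:
  "eta p b0 b1 t = Lq_norm p {0<..<t} (weight p b0) / Lq_norm p {0<..<t} (weight p b1)"
  by (simp add: eta_def weight_def)

lemma eta_mult:
  assumes "0 < p" "b0 \<in> SV1 p" "b1 \<in> SV1 p" "0 < t"
  shows "eta p b0 b1 t * Lq_norm p {0<..<t} (weight p b1) = Lq_norm p {0<..<t} (weight p b0)"
    and "0 < eta p b0 b1 t" and "eta p b0 b1 t < \<infinity>"
proof -
  have pos: "0 < Lq_norm p {0<..<t} (weight p b)" if "b \<in> SV1 p" for b
    using weight_tail_initial[OF assms(1) that] assms(4) by metis
  have fin: "Lq_norm p {0<..<t} (weight p b) < \<infinity>" if "b \<in> SV1 p" for b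
    by (rule weight_finite[OF assms(1) that assms(4)])
  have "inverse (Lq_norm p {0<..<t} (weight p b1)) * Lq_norm p {0<..<t} (weight p b1) = 1"
    using ennreal_divide_self[of "Lq_norm p {0<..<t} (weight p b1)"] pos[OF assms(3)] fin[OF assms(3)]
    by (simp add: divide_ennreal_def mult.commute)
  then show "eta p b0 b1 t * Lq_norm p {0<..<t} (weight p b1) = Lq_norm p {0<..<t} (weight p b0)"
    by (simp add: eta_eq divide_ennreal_def mult.assoc)
  show "0 < eta p b0 b1 t"
    using pos[OF assms(2)] fin[OF assms(3)] unfolding eta_eq
    by (simp add: zero_less_iff_neq_zero divide_ennreal_def less_top)
  show "eta p b0 b1 t < \<infinity>"
    using pos[OF assms(3)] fin[OF assms(2)] unfolding eta_eq
    by (auto simp: ennreal_divide_eq_top_iff less_top[symmetric])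
qed

lemma qnorm_interp_space:
  "f \<in> carrier (interp_space A0 A1 1 p b) \<longleftrightarrow> f \<in> carrier A0 + carrier A1 \<and> interp_norm A0 A1 1 p b f < \<infinity>"
  "f \<in> carrier (interp_space A0 A1 1 p b) \<Longrightarrow>
    ennreal (qnorm (interp_space A0 A1 1 p b) f) = interp_norm A0 A1 1 p b f"
  by (auto simp: interp_space_def less_top)

lemma K_quotient_weight_measurable:
  assumes "b \<in> SV1 p" "S \<subseteq> {0<..}"
  shows "(\<lambda>u. K_quotient A0 A1 f u * weight p b u) \<in> borel_measurable (lebesgue_on S)"
proof -
  note [measurable] = borel_measurable_antimono_on[OF K_quotient_antimono] weight_measurable[OF assms(1)]
  have "(\<lambda>u. K_quotient A0 A1 f u * weight p b u) \<in> borel_measurable (lebesgue_on {0<..})"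
    by measurable
  then show ?thesis using assms(2) by (rule measurable_restrict_mono)
qed

text \<open>Let \<open>f = f0 + f1\<close>. The part of \<open>f0\<close> in \<open>I\<^sub>1\<close> and the part of \<open>f1\<close> in \<open>J\<^sub>1\<close> are restrictions of the
  corresponding quasi-norms. The two mixed parts change the weight, and the comparison principle
  applies to them since \<open>\<eta>\<close> is monotone.\<close>
lemma Holmstedt_lower:
  fixes A0 A1 :: "'a::real_vector qspace"
  assumes A: "quasi_normed_space A0" "quasi_normed_space A1"
    and p: "0 < p" and b0: "b0 \<in> SV1 p" and b1: "b1 \<in> SV1 p"
    and mono: "mono_on {0<..} (eta p b0 b1)"
  shows "\<exists>c>0. \<forall>f. \<forall>t>0. I1 A0 A1 p b0 t f + eta p b0 b1 t * J1 A0 A1 p b1 t f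
    \<le> ennreal c * K_functional (eta p b0 b1 t) f (interp_space A0 A1 1 p b0) (interp_space A0 A1 1 p b1)"
proof -
  obtain C where C: "1 \<le> C" "\<And>f g t. K_functional t (f + g) A0 A1 \<le>
    ennreal C * (K_functional t f A0 A1 + K_functional t g A0 A1)"
    by (rule K_functional_triangle[OF A]) (rule that)
  define D where "D = C * triangle_const p"
  have D: "0 < D" using C triangle_const_ge[of p] by (simp add: D_def)
  let ?k = "K_quotient A0 A1" and ?N = "Lq_norm p" and ?w0 = "weight p b0" and ?w1 = "weight p b1"
  let ?X0 = "interp_space A0 A1 1 p b0" and ?X1 = "interp_space A0 A1 1 p b1"
  note km = K_quotient_weight_measurable
  have kadd: "?k (f + g) u \<le> ennreal C * (?k f u + ?k g u)" for f g u
  proof -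
    have "?k (f + g) u \<le> ennreal (1 / u) * (ennreal C * (K_functional (ennreal u) f A0 A1 + K_functional (ennreal u) g A0 A1))"
      unfolding K_quotient_def by (intro mult_left_mono C(2)) simp
    then show ?thesis by (simp add: K_quotient_def algebra_simps)
  qed
  have nadd: "?N S (\<lambda>u. ?k (f + g) u * weight p b u)
      \<le> ennreal D * (?N S (\<lambda>u. ?k f u * weight p b u) + ?N S (\<lambda>u. ?k g u * weight p b u))"
    if b: "b \<in> SV1 p" and S: "S \<subseteq> {0<..}" for S f g b
  proof -
    note m = km[OF b S, of A0 A1]
    have "?N S (\<lambda>u. ?k (f + g) u * weight p b u)
        \<le> ?N S (\<lambda>u. ennreal C * (?k f u * weight p b u + ?k g u * weight p b u))"
    proof (intro Lq_norm_mono[OF p m])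
      fix u
      show "?k (f + g) u * weight p b u \<le> ennreal C * (?k f u * weight p b u + ?k g u * weight p b u)"
        using mult_right_mono[OF kadd[of f g u], of "weight p b u"] by (simp add: algebra_simps)
    qed
    also have "\<dots> = ennreal C * ?N S (\<lambda>u. ?k f u * weight p b u + ?k g u * weight p b u)"
      by (intro Lq_norm_cmult[OF p] borel_measurable_add m) simp
    also have "\<dots> \<le> ennreal C * (ennreal (triangle_const p) *
        (?N S (\<lambda>u. ?k f u * weight p b u) + ?N S (\<lambda>u. ?k g u * weight p b u)))"
      by (intro mult_left_mono Lq_norm_triangle[OF p m m]) simp
    also have "\<dots> = ennreal D * (?N S (\<lambda>u. ?k f u * weight p b u) + ?N S (\<lambda>u. ?k g u * weight p b u))"
      using C triangle_const_ge[of p] by (simp add: D_def ennreal_mult mult.assoc)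
    finally show ?thesis .
  qed
  have w: "?w0 \<in> borel_measurable (lebesgue_on {0<..})" "?w1 \<in> borel_measurable (lebesgue_on {0<..})"
    using weight_measurable b0 b1 by auto
  have main: "I1 A0 A1 p b0 t f + eta p b0 b1 t * J1 A0 A1 p b1 t f
      \<le> ennreal (3 * D) * (ennreal (qnorm ?X0 f0) + eta p b0 b1 t * ennreal (qnorm ?X1 f1))"
    if t: "0 < t" and f0: "f0 \<in> carrier ?X0" and f1: "f1 \<in> carrier ?X1" and f: "f = f0 + f1" for t f f0 f1
  proof -
    define e where "e = eta p b0 b1 t"
    have e: "e < \<infinity>" unfolding e_def by (rule eta_mult(3)[OF p b0 b1 t])
    define x where "x = ennreal (qnorm ?X0 f0)"
    define y where "y = ennreal (qnorm ?X1 f1)"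
    have x: "x = ?N {0<..} (\<lambda>u. ?k f0 u * ?w0 u)" and y: "y = ?N {0<..} (\<lambda>u. ?k f1 u * ?w1 u)"
      using f0 f1 by (simp_all add: x_def y_def qnorm_interp_space(2) interp_norm_eq)
    have fin: "?k f0 u < \<infinity>" "?k f1 u < \<infinity>" for u
      using f0 f1 K_quotient_finite[of _ A0 A1 u] by (auto simp: qnorm_interp_space(1))
    have up: "?N {0<..<r} ?w0 \<le> e * ?N {0<..<r} ?w1" if "0 < r" "r \<le> t" for r
    proof -
      have "eta p b0 b1 r \<le> e" using monotone_onD[OF mono, of r t] that t by (simp add: e_def)
      then show ?thesis using mult_right_mono[of "eta p b0 b1 r" e "?N {0<..<r} ?w1"]
        by (simp add: eta_mult(1)[OF p b0 b1 that(1)])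
    qed
    have lo: "e * ?N {0<..<r} ?w1 \<le> ?N {0<..<r} ?w0" if "t \<le> r" for r
    proof -
      have "e \<le> eta p b0 b1 r" using monotone_onD[OF mono, of t r] that t by (simp add: e_def)
      moreover have "0 < r" using t that by simp
      ultimately show ?thesis using mult_right_mono[of e "eta p b0 b1 r" "?N {0<..<r} ?w1"]
        by (simp add: eta_mult(1)[OF p b0 b1])
    qed
    have i0: "?N {0<..<t} (\<lambda>u. ?k f0 u * ?w0 u) \<le> x"
      unfolding x by (intro Lq_norm_mono_set[OF p km[OF b0]]) auto
    have i1: "?N {0<..<t} (\<lambda>u. ?k f1 u * ?w0 u) \<le> 2 * (e * y)"
      unfolding y by (intro initial_part_le[OF p K_quotient_antimono K_quotient_doubling fin(2) w e t up])
    have j0: "e * ?N {t<..} (\<lambda>u. ?k f0 u * ?w1 u) \<le> 2 * x"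
      unfolding x by (intro final_part_le[OF p K_quotient_antimono K_quotient_doubling fin(1) w e t lo])
    have j1: "?N {t<..} (\<lambda>u. ?k f1 u * ?w1 u) \<le> y"
      unfolding y using t by (intro Lq_norm_mono_set[OF p km[OF b1]]) auto
    have "I1 A0 A1 p b0 t f \<le> ennreal D * (x + 2 * (e * y))"
      unfolding I1_eq f
      by (intro order_trans[OF nadd[OF b0]] mult_left_mono add_mono i0 i1) auto
    moreover have "e * J1 A0 A1 p b1 t f \<le> ennreal D * (2 * x + e * y)"
    proof -
      have "e * J1 A0 A1 p b1 t f \<le> e * (ennreal D * (?N {t<..} (\<lambda>u. ?k f0 u * ?w1 u) + ?N {t<..} (\<lambda>u. ?k f1 u * ?w1 u)))"
        unfolding J1_eq[OF t] f using t by (intro mult_left_mono nadd[OF b1]) auto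
      also have "\<dots> = ennreal D * (e * ?N {t<..} (\<lambda>u. ?k f0 u * ?w1 u) + e * ?N {t<..} (\<lambda>u. ?k f1 u * ?w1 u))"
        by (simp add: algebra_simps)
      also have "\<dots> \<le> ennreal D * (2 * x + e * y)"
        by (intro mult_left_mono add_mono j0 j1) auto
      finally show ?thesis .
    qed
    ultimately have "I1 A0 A1 p b0 t f + e * J1 A0 A1 p b1 t f
        \<le> ennreal D * (x + 2 * (e * y)) + ennreal D * (2 * x + e * y)" by (rule add_mono)
    also have "\<dots> = ennreal D * (3 * (x + e * y))"
    proof -
      have "x + 2 * (e * y) + (2 * x + e * y) = (1 + 2) * x + (2 + 1) * (e * y)"
        by (simp only: distrib_right mult_1 add_ac)
      also have "\<dots> = 3 * (x + e * y)" by (simp add: distrib_left)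
      finally show ?thesis by (simp only: distrib_left[symmetric])
    qed
    also have "\<dots> = ennreal (3 * D) * (x + e * y)"
      using D by (simp add: ennreal_mult mult_ac)
    finally show ?thesis by (simp add: e_def x_def y_def)
  qed
  show ?thesis
  proof (intro exI[of _ "3 * D"] conjI allI impI)
    fix f and t :: real assume t: "0 < t"
    let ?R = "I1 A0 A1 p b0 t f + eta p b0 b1 t * J1 A0 A1 p b1 t f"
    have inv: "ennreal (1 / (3 * D)) * (ennreal (3 * D) * z) = z"
      "ennreal (3 * D) * (ennreal (1 / (3 * D)) * z) = z" for z
      using D by (simp_all flip: mult.assoc ennreal_mult)
    have "ennreal (1 / (3 * D)) * ?R \<le> K_functional (eta p b0 b1 t) f ?X0 ?X1"
    proof (rule K_functional_greatest)
      fix f0 f1 assume "f0 \<in> carrier ?X0" "f1 \<in> carrier ?X1" "f = f0 + f1"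
      then have "ennreal (1 / (3 * D)) * ?R \<le> ennreal (1 / (3 * D)) *
          (ennreal (3 * D) * (ennreal (qnorm ?X0 f0) + eta p b0 b1 t * ennreal (qnorm ?X1 f1)))"
        by (intro mult_left_mono main t) auto
      then show "ennreal (1 / (3 * D)) * ?R
          \<le> ennreal (qnorm ?X0 f0) + eta p b0 b1 t * ennreal (qnorm ?X1 f1)"
        by (simp only: inv)
    qed
    then have "ennreal (3 * D) * (ennreal (1 / (3 * D)) * ?R)
        \<le> ennreal (3 * D) * K_functional (eta p b0 b1 t) f ?X0 ?X1"
      by (rule mult_left_mono) simp
    then show "?R \<le> ennreal (3 * D) * K_functional (eta p b0 b1 t) f ?X0 ?X1"
      by (simp only: inv)
  qed (use D in simp)
qed

text \<open>Take \<open>f = f0 + f1\<close> with \<open>\<parallel>f0\<parallel> + t \<parallel>f1\<parallel> < a\<close>, where \<open>a > K(t,f)\<close>. Then \<open>K(u,f0) \<le> a\<close> and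
  \<open>K(u,f1) \<le> u a/t\<close> for all \<open>u\<close>. The first bound serves for \<open>u > t\<close> and the second one for
  \<open>u < t\<close>. In the remaining ranges \<open>f0 = f - f1\<close> and \<open>f1 = f - f0\<close> reduce to \<open>f\<close> and the bound for the
  other summand. The identity \<open>\<eta>(t) B\<^sub>1(t) = B\<^sub>0(t)\<close> gives the error terms of both summands the
  common form \<open>a B\<^sub>0(t)/t\<close>. Since \<open>K(t,f)\<close> may vanish, \<open>a\<close> is not taken proportional to it but
  tends to it.\<close>
lemma Holmstedt_upper:
  fixes A0 A1 :: "'a::real_vector qspace"
  assumes A: "quasi_normed_space A0" "quasi_normed_space A1"
    and p: "0 < p" and b0: "b0 \<in> SV1 p" and b1: "b1 \<in> SV1 p"
  shows "\<exists>c>0. \<forall>f\<in>carrier A0 + carrier A1. \<forall>t>0.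
    K_functional (eta p b0 b1 t) f (interp_space A0 A1 1 p b0) (interp_space A0 A1 1 p b1)
      \<le> ennreal c * (I1 A0 A1 p b0 t f + eta p b0 b1 t * J1 A0 A1 p b1 t f)"
proof -
  obtain C where C: "1 \<le> C" "\<And>f g t. K_functional t (f + g) A0 A1 \<le>
    ennreal C * (K_functional t f A0 A1 + K_functional t g A0 A1)"
    by (rule K_functional_triangle[OF A]) (rule that)
  define T where "T = triangle_const p"
  define D where "D = C * T"
  have T: "2 \<le> T" using triangle_const_ge[of p] by (simp add: T_def)
  have D: "1 \<le> D" using mult_mono[of 1 C 1 T] C T by (simp add: D_def)
  let ?k = "K_quotient A0 A1" and ?N = "Lq_norm p" and ?w0 = "weight p b0" and ?w1 = "weight p b1"
  let ?X0 = "interp_space A0 A1 1 p b0" and ?X1 = "interp_space A0 A1 1 p b1"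
  note km = K_quotient_weight_measurable
  have wm: "weight p b \<in> borel_measurable (lebesgue_on S)" if "b \<in> SV1 p" "S \<subseteq> {0<..}" for b S
    using measurable_restrict_mono[OF weight_measurable[OF that(1)] that(2)] .
  have wu: "(\<lambda>u. ennreal (1 / u) * weight p b u) \<in> borel_measurable (lebesgue_on S)"
    if "b \<in> SV1 p" "S \<subseteq> {0<..}" for b S
    using wm[OF that] by measurable
  obtain c0 where c0: "0 < c0" "\<And>t. 0 < t \<Longrightarrow> ?N {t<..} (\<lambda>u. ennreal (1 / u) * ?w0 u)
       \<le> ennreal c0 * (ennreal (1 / t) * ?N {0<..<t} ?w0)"
    using weight_tail_initial[OF p b0] by metis
  obtain c1 where c1: "0 < c1" "\<And>t. 0 < t \<Longrightarrow> ?N {t<..} (\<lambda>u. ennreal (1 / u) * ?w1 u)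
       \<le> ennreal c1 * (ennreal (1 / t) * ?N {0<..<t} ?w1)"
    using weight_tail_initial[OF p b1] by metis
  have affine: "?N S (\<lambda>u. ennreal C * (g u + a * h u)) \<le> ennreal D * (?N S g + a * ?N S h)"
    if g: "g \<in> borel_measurable (lebesgue_on S)" and h: "h \<in> borel_measurable (lebesgue_on S)"
      and a: "a < \<infinity>" for S g h a
  proof -
    have ah: "(\<lambda>u. a * h u) \<in> borel_measurable (lebesgue_on S)" using h by measurable
    have "?N S (\<lambda>u. ennreal C * (g u + a * h u)) = ennreal C * ?N S (\<lambda>u. g u + a * h u)"
      using g h by (intro Lq_norm_cmult[OF p]) auto
    also have "\<dots> \<le> ennreal C * (ennreal T * (?N S g + ?N S (\<lambda>u. a * h u)))"
      unfolding T_def by (intro mult_left_mono Lq_norm_triangle[OF p g ah]) simp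
    also have "?N S (\<lambda>u. a * h u) = a * ?N S h" by (rule Lq_norm_cmult[OF p h a])
    finally show ?thesis using C T by (simp add: D_def ennreal_mult mult.assoc)
  qed
  have split: "?N {0<..} g \<le> ennreal T * (?N {0<..<t} g + ?N {t<..} g)"
    if t: "0 < t" and g: "g \<in> borel_measurable (lebesgue_on {0<..})" for t g
  proof -
    have "AE u in lebesgue. u \<noteq> t" by (intro AE_completion) (rule AE_lborel_singleton)
    then have "AE u in lebesgue_on {0<..}. u \<in> {0<..<t} \<union> {t<..}"
      by (subst AE_restrict_space_iff) (auto elim!: eventually_mono)
    then show ?thesis unfolding T_def using t g by (intro Lq_norm_split[OF p]) auto
  qed
  \<comment> \<open>Here \<open>T\<close> comes from splitting the half-line at \<open>t\<close>, \<open>D\<close> from the two quasi-triangle inequalities, and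
    \<open>c0\<close>, \<open>c1\<close> from the tails of the weights.\<close>
  define M where "M = T * D * (2 + c0 + c1)"
  have M: "0 < M" using T D c0 c1 by (simp add: M_def)
  have zero: "0 \<in> carrier A0" "0 \<in> carrier A1"
    using A by (auto intro: subspace_0 quasi_normed_space_subspace)
  have minus: "x \<in> carrier A0 \<Longrightarrow> - x \<in> carrier A0" "x \<in> carrier A1 \<Longrightarrow> - x \<in> carrier A1" for x
    using A by (auto intro: subspace_neg quasi_normed_space_subspace)
  have K0: "K_functional s g A0 A1 \<le> ennreal (qnorm A0 g)" if "g \<in> carrier A0" for s g
    using K_functional_le[OF that zero(2), of s] qnorm_zero[OF A(2)] by simp
  have K1: "K_functional s g A0 A1 \<le> s * ennreal (qnorm A1 g)" if "g \<in> carrier A1" for s g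
    using K_functional_le[OF zero(1) that, of s] qnorm_zero[OF A(1)] by simp
  \<comment> \<open>The estimate for a fixed \<open>a\<close>, with the error term still present.\<close>
  have main: "K_functional (eta p b0 b1 t) f ?X0 ?X1 \<le> ennreal M *
      (I1 A0 A1 p b0 t f + eta p b0 b1 t * J1 A0 A1 p b1 t f + ennreal (a / t) * ?N {0<..<t} ?w0)"
    if t: "0 < t" and a0: "0 < a" and a: "K_functional (ennreal t) f A0 A1 < ennreal a" for t f a
  proof (cases "I1 A0 A1 p b0 t f + eta p b0 b1 t * J1 A0 A1 p b1 t f < \<infinity>")
    case False
    then have "I1 A0 A1 p b0 t f + eta p b0 b1 t * J1 A0 A1 p b1 t f = top"
      by (metis infinity_ennreal_def less_top)
    then show ?thesis using M by (simp only: ennreal_mult_top top_add ennreal_eq_0_iff) simp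
  next
    case finR: True
    define e where "e = eta p b0 b1 t"
    note eta = eta_mult[OF p b0 b1 t, folded e_def]
    define B where "B = ?N {0<..<t} ?w0"
    define x where "x = ennreal (a / t) * B"
    have B: "B < \<infinity>" unfolding B_def by (rule weight_finite[OF p b0 t])
    obtain f0 f1 where f: "f0 \<in> carrier A0" "f1 \<in> carrier A1" "f = f0 + f1"
      and lt: "ennreal (qnorm A0 f0) + ennreal t * ennreal (qnorm A1 f1) < ennreal a"
      by (rule K_functional_near_optimal[OF a]) (rule that)
    have n0: "ennreal (qnorm A0 f0) \<le> ennreal a"
      using lt by (meson add_increasing2 less_imp_le not_le order_refl zero_le)
    have n1: "ennreal (qnorm A1 f1) \<le> ennreal (a / t)"
    proof -
      have "ennreal t * ennreal (qnorm A1 f1) \<le> ennreal a"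
        using lt by (meson add_increasing less_imp_le not_le order_refl zero_le)
      then have "t * qnorm A1 f1 \<le> a"
        using t a0 qnorm_nonneg[OF A(2) f(2)] by (simp add: ennreal_mult[symmetric] ennreal_le_iff)
      then show ?thesis using t by (intro ennreal_leI) (simp add: field_simps)
    qed
    have kf0: "?k f0 u \<le> ennreal a * ennreal (1 / u)" for u
      unfolding K_quotient_def mult.commute[of "ennreal a"]
      by (intro mult_left_mono order_trans[OF K0[OF f(1)] n0]) simp
    have kf1': "?k g u \<le> ennreal (a / t)" if u: "0 < u" and g: "g = f1 \<or> g = - f1" for u g
    proof -
      have "?k g u \<le> ennreal (1 / u) * (ennreal u * ennreal (a / t))"
        unfolding K_quotient_def using f(2) g n1 minus(2)[OF f(2)] qnorm_minus[OF A(2) f(2)]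
        by (intro mult_left_mono order_trans[OF K1 mult_left_mono]) auto
      also have "\<dots> = ennreal (a / t)" using u by (simp flip: mult.assoc ennreal_mult)
      finally show ?thesis .
    qed
    have kf0': "?k (- f0) u \<le> ennreal a * ennreal (1 / u)" for u
      unfolding K_quotient_def mult.commute[of "ennreal a"]
      using n0 qnorm_minus[OF A(1) f(1)]
      by (intro mult_left_mono order_trans[OF K0[OF minus(1)[OF f(1)]]]) auto
    have kadd: "?k (g + h) u \<le> ennreal C * (?k g u + ?k h u)" for g h u
    proof -
      have "?k (g + h) u \<le> ennreal (1 / u) * (ennreal C * (K_functional (ennreal u) g A0 A1 + K_functional (ennreal u) h A0 A1))"
        unfolding K_quotient_def by (intro mult_left_mono C(2)) simp
      then show ?thesis by (simp add: K_quotient_def algebra_simps)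
    qed
    have k0: "?k f0 u \<le> ennreal C * (?k f u + ennreal (a / t))" if u: "0 < u" for u
    proof -
      have "?k f0 u \<le> ennreal C * (?k f u + ?k (- f1) u)" using kadd[of f "- f1" u] f(3) by simp
      also have "\<dots> \<le> ennreal C * (?k f u + ennreal (a / t))"
        using kf1'[OF u] by (intro mult_left_mono add_left_mono) auto
      finally show ?thesis .
    qed
    have k1: "?k f1 u \<le> ennreal C * (?k f u + ennreal a * ennreal (1 / u))" for u
    proof -
      have "?k f1 u \<le> ennreal C * (?k f u + ?k (- f0) u)" using kadd[of f "- f0" u] f(3) by simp
      also have "\<dots> \<le> ennreal C * (?k f u + ennreal a * ennreal (1 / u))"
        using kf0' by (intro mult_left_mono add_left_mono) auto
      finally show ?thesis .
    qed
    have aw: "ennreal a * (ennreal (1 / t) * z) = ennreal (a / t) * z" for z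
      using t a0 by (simp flip: mult.assoc ennreal_mult)
    define x0 where "x0 = interp_norm A0 A1 1 p b0 f0"
    define x1 where "x1 = interp_norm A0 A1 1 p b1 f1"
    define I where "I = I1 A0 A1 p b0 t f"
    define J where "J = J1 A0 A1 p b1 t f"
    have x0: "x0 \<le> ennreal T * (ennreal D * (I + x) + ennreal c0 * x)"
    proof -
      have i: "?N {0<..<t} (\<lambda>u. ?k f0 u * ?w0 u) \<le> ennreal D * (I + x)"
      proof -
        have "?N {0<..<t} (\<lambda>u. ?k f0 u * ?w0 u)
            \<le> ?N {0<..<t} (\<lambda>u. ennreal C * (?k f u * ?w0 u + ennreal (a / t) * ?w0 u))"
        proof (intro Lq_norm_mono[OF p km[OF b0]])
          fix u assume "u \<in> {0<..<t}"
          then show "?k f0 u * ?w0 u \<le> ennreal C * (?k f u * ?w0 u + ennreal (a / t) * ?w0 u)"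
            using mult_right_mono[OF k0[of u], of "?w0 u"] by (simp add: algebra_simps)
        qed auto
        also have "\<dots> \<le> ennreal D * (?N {0<..<t} (\<lambda>u. ?k f u * ?w0 u) + ennreal (a / t) * ?N {0<..<t} ?w0)"
          by (intro affine km[OF b0] wm[OF b0]) auto
        finally show ?thesis by (simp add: I_def x_def B_def I1_eq)
      qed
      have j: "?N {t<..} (\<lambda>u. ?k f0 u * ?w0 u) \<le> ennreal c0 * x"
      proof -
        have "?N {t<..} (\<lambda>u. ?k f0 u * ?w0 u) \<le> ?N {t<..} (\<lambda>u. ennreal a * (ennreal (1 / u) * ?w0 u))"
          using t mult_right_mono[OF kf0]
          by (intro Lq_norm_mono[OF p km[OF b0]]) (auto simp: mult.assoc)
        also have "\<dots> = ennreal a * ?N {t<..} (\<lambda>u. ennreal (1 / u) * ?w0 u)"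
          using t by (intro Lq_norm_cmult[OF p] wu[OF b0]) auto
        also have "\<dots> \<le> ennreal a * (ennreal c0 * (ennreal (1 / t) * B))"
          unfolding B_def by (intro mult_left_mono c0(2) t) simp
        also have "\<dots> = ennreal c0 * x" unfolding x_def aw[symmetric] by (simp only: mult_ac)
        finally show ?thesis .
      qed
      have "x0 \<le> ennreal T * (?N {0<..<t} (\<lambda>u. ?k f0 u * ?w0 u) + ?N {t<..} (\<lambda>u. ?k f0 u * ?w0 u))"
        unfolding x0_def interp_norm_eq by (intro split t km[OF b0]) auto
      also have "\<dots> \<le> ennreal T * (ennreal D * (I + x) + ennreal c0 * x)"
        by (intro mult_left_mono add_mono i j) simp
      finally show ?thesis .
    qed
    have eB: "e * (ennreal (a / t) * ?N {0<..<t} ?w1) = x"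
      unfolding x_def B_def eta(1)[symmetric] by (simp only: mult_ac)
    have x1: "e * x1 \<le> ennreal T * (x + ennreal D * (e * J + ennreal c1 * x))"
    proof -
      have i: "?N {0<..<t} (\<lambda>u. ?k f1 u * ?w1 u) \<le> ennreal (a / t) * ?N {0<..<t} ?w1"
      proof -
        have "?N {0<..<t} (\<lambda>u. ?k f1 u * ?w1 u) \<le> ?N {0<..<t} (\<lambda>u. ennreal (a / t) * ?w1 u)"
          by (intro Lq_norm_mono[OF p km[OF b1]] mult_right_mono kf1') auto
        also have "\<dots> = ennreal (a / t) * ?N {0<..<t} ?w1"
          by (intro Lq_norm_cmult[OF p] wm[OF b1]) auto
        finally show ?thesis .
      qed
      have j: "?N {t<..} (\<lambda>u. ?k f1 u * ?w1 u)
          \<le> ennreal D * (J + ennreal c1 * (ennreal (a / t) * ?N {0<..<t} ?w1))"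
      proof -
        have sub: "{t<..} \<subseteq> {0<..}" using t by auto
        have "?N {t<..} (\<lambda>u. ?k f1 u * ?w1 u)
            \<le> ?N {t<..} (\<lambda>u. ennreal C * (?k f u * ?w1 u + ennreal a * (ennreal (1 / u) * ?w1 u)))"
        proof (intro Lq_norm_mono[OF p km[OF b1 sub]])
          fix u assume "u \<in> {t<..}"
          then show "?k f1 u * ?w1 u \<le> ennreal C * (?k f u * ?w1 u + ennreal a * (ennreal (1 / u) * ?w1 u))"
            using mult_right_mono[OF k1[of u], of "?w1 u"] by (simp add: algebra_simps)
        qed
        also have "\<dots> \<le> ennreal D * (J + ennreal a * ?N {t<..} (\<lambda>u. ennreal (1 / u) * ?w1 u))"
          unfolding J_def J1_eq[OF t] by (intro affine km[OF b1 sub] wu[OF b1 sub]) simp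
        also have "\<dots> \<le> ennreal D * (J + ennreal a * (ennreal c1 * (ennreal (1 / t) * ?N {0<..<t} ?w1)))"
          by (intro mult_left_mono add_left_mono c1(2) t) auto
        also have "ennreal a * (ennreal c1 * (ennreal (1 / t) * ?N {0<..<t} ?w1))
            = ennreal c1 * (ennreal (a / t) * ?N {0<..<t} ?w1)"
          unfolding aw[symmetric] by (simp only: mult_ac)
        finally show ?thesis .
      qed
      have "x1 \<le> ennreal T * (?N {0<..<t} (\<lambda>u. ?k f1 u * ?w1 u) + ?N {t<..} (\<lambda>u. ?k f1 u * ?w1 u))"
        unfolding x1_def interp_norm_eq by (intro split t km[OF b1]) auto
      also have "\<dots> \<le> ennreal T * (ennreal (a / t) * ?N {0<..<t} ?w1
          + ennreal D * (J + ennreal c1 * (ennreal (a / t) * ?N {0<..<t} ?w1)))"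
        by (intro mult_left_mono add_mono i j) simp
      finally have "e * x1 \<le> e * (ennreal T * (ennreal (a / t) * ?N {0<..<t} ?w1
          + ennreal D * (J + ennreal c1 * (ennreal (a / t) * ?N {0<..<t} ?w1))))"
        by (rule mult_left_mono) simp
      also have "\<dots> = ennreal T * (e * (ennreal (a / t) * ?N {0<..<t} ?w1)
          + ennreal D * (e * J + ennreal c1 * (e * (ennreal (a / t) * ?N {0<..<t} ?w1))))"
        by (simp only: distrib_left mult_ac)
      finally show ?thesis by (simp only: eB)
    qed
    have "x0 + e * x1 \<le> ennreal T * (ennreal D * (I + x) + ennreal c0 * x)
        + ennreal T * (x + ennreal D * (e * J + ennreal c1 * x))"
      by (intro add_mono x0 x1)
    also have "\<dots> \<le> ennreal T * (ennreal D * (I + x) + ennreal D * (ennreal c0 * x))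
        + ennreal T * (ennreal D * x + ennreal D * (e * J + ennreal c1 * x))"
      using D mult_right_mono[of 1 "ennreal D"] by (intro add_mono mult_left_mono) auto
    also have "\<dots> = ennreal T * (ennreal D * ((I + e * J) + (2 + ennreal c0 + ennreal c1) * x))"
    proof -
      have "(2 + ennreal c0 + ennreal c1) * x = x + x + ennreal c0 * x + ennreal c1 * x"
        by (simp add: distrib_right mult_2)
      then show ?thesis by (simp only: distrib_left add_ac)
    qed
    also have "\<dots> \<le> ennreal T * (ennreal D * ((2 + ennreal c0 + ennreal c1) * (I + e * J) + (2 + ennreal c0 + ennreal c1) * x))"
    proof -
      have "1 \<le> 2 + ennreal c0 + ennreal c1"
        by (metis add.assoc le_add_same_cancel1 one_le_numeral order_trans zero_le add_increasing2)
      then have "1 * (I + e * J) \<le> (2 + ennreal c0 + ennreal c1) * (I + e * J)"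
        by (rule mult_right_mono) simp
      then show ?thesis by (intro mult_left_mono add_right_mono) auto
    qed
    also have "\<dots> = ennreal M * (I + e * J + x)"
    proof -
      have "ennreal M = ennreal T * (ennreal D * (2 + ennreal c0 + ennreal c1))"
        using T D c0(1) c1(1) by (simp add: M_def ennreal_mult ennreal_plus mult.assoc)
      then show ?thesis by (simp only: distrib_left[symmetric] mult.assoc)
    qed
    finally have le: "x0 + e * x1 \<le> ennreal M * (I + e * J + x)" .
    \<comment> \<open>Finiteness of the bound is what places the summands in the interpolation spaces.\<close>
    have "I + e * J < \<infinity>" using finR by (simp add: I_def J_def e_def)
    moreover have "x < \<infinity>" using B by (simp add: x_def ennreal_mult_less_top)
    ultimately have "ennreal M * (I + e * J + x) < \<infinity>" by (simp add: ennreal_mult_less_top)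
    then have fin: "x0 + e * x1 < \<infinity>" using le by (rule order_le_less_trans[rotated])
    then have "x0 < \<infinity>" "x1 < \<infinity>" using eta(2) by (auto simp: ennreal_mult_less_top)
    moreover have "f0 \<in> carrier A0 + carrier A1" "f1 \<in> carrier A0 + carrier A1"
      using set_plus_intro[OF f(1) zero(2)] set_plus_intro[OF zero(1) f(2)] by simp_all
    ultimately have mem: "f0 \<in> carrier ?X0" "f1 \<in> carrier ?X1"
      by (auto simp: qnorm_interp_space(1) x0_def x1_def)
    have "K_functional e f ?X0 ?X1 \<le> ennreal (qnorm ?X0 f0) + e * ennreal (qnorm ?X1 f1)"
      unfolding f(3) by (rule K_functional_le[OF mem])
    also have "\<dots> = x0 + e * x1" using mem by (simp add: qnorm_interp_space(2) x0_def x1_def)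
    finally show ?thesis using le by (simp add: I_def J_def e_def x_def B_def)
  qed
  show ?thesis
  proof (intro exI[of _ "2 * M"] conjI ballI allI impI)
    fix f and t :: real assume f: "f \<in> carrier A0 + carrier A1" and t: "0 < t"
    let ?R = "I1 A0 A1 p b0 t f + eta p b0 b1 t * J1 A0 A1 p b1 t f"
    define B where "B = ?N {0<..<t} ?w0"
    have B: "B < \<infinity>" unfolding B_def by (rule weight_finite[OF p b0 t])
    have Kfin: "K_functional (ennreal t) f A0 A1 < \<infinity>" by (rule K_functional_finite[OF f]) simp
    define \<kappa> where "\<kappa> = enn2real (K_functional (ennreal t) f A0 A1)"
    have \<kappa>: "K_functional (ennreal t) f A0 A1 = ennreal \<kappa>" "0 \<le> \<kappa>"
      using Kfin by (auto simp: \<kappa>_def less_top)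
    \<comment> \<open>The error term at \<open>a = K(t,f)\<close> is absorbed by \<open>I\<^sub>1\<close>.\<close>
    have kI: "ennreal (\<kappa> / t) * B \<le> I1 A0 A1 p b0 t f"
    proof -
      have kt: "?k f t = ennreal (\<kappa> / t)"
        unfolding K_quotient_def \<kappa>(1) using t \<kappa>(2) by (simp flip: ennreal_mult)
      have "ennreal (\<kappa> / t) * B = ?N {0<..<t} (\<lambda>u. ennreal (\<kappa> / t) * ?w0 u)"
        unfolding B_def by (intro Lq_norm_cmult[OF p, symmetric] wm[OF b0]) auto
      also have "\<dots> \<le> ?N {0<..<t} (\<lambda>u. ?k f u * ?w0 u)"
      proof (intro Lq_norm_mono[OF p])
        fix u assume u: "u \<in> {0<..<t}"
        have "?k f t \<le> ?k f u"
          using monotone_onD[OF K_quotient_antimono, of u t] u by auto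
        then show "ennreal (\<kappa> / t) * ?w0 u \<le> ?k f u * ?w0 u"
          unfolding kt by (rule mult_right_mono) simp
      qed (use wm[OF b0, of "{0<..<t}"] in measurable, auto)
      finally show ?thesis by (simp add: I1_eq)
    qed
    show "K_functional (eta p b0 b1 t) f ?X0 ?X1 \<le> ennreal (2 * M) * ?R"
    proof (rule ennreal_le_epsilon)
      fix \<epsilon> :: real assume \<epsilon>: "0 < \<epsilon>"
      define \<beta> where "\<beta> = enn2real B"
      have \<beta>: "B = ennreal \<beta>" "0 \<le> \<beta>" using B by (auto simp: \<beta>_def less_top)
      \<comment> \<open>The excess of \<open>a\<close> over \<open>K(t,f)\<close> that contributes at most \<open>\<epsilon>\<close>; adding \<open>1\<close> avoids a positivity argument for \<open>\<beta>\<close>.\<close>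
      define d where "d = \<epsilon> * t / (M * (\<beta> + 1))"
      have d: "0 < d" using \<epsilon> t M \<beta> by (simp add: d_def)
      have "K_functional (eta p b0 b1 t) f ?X0 ?X1 \<le> ennreal M * (?R + ennreal ((\<kappa> + d) / t) * B)"
        unfolding B_def using \<kappa> d by (intro main t) (auto simp: ennreal_less_iff)
      also have "ennreal ((\<kappa> + d) / t) * B = ennreal (\<kappa> / t) * B + ennreal (d / t) * B"
        using \<kappa> d t by (simp add: add_divide_distrib ennreal_plus distrib_right)
      also have "ennreal M * (?R + (ennreal (\<kappa> / t) * B + ennreal (d / t) * B))
          \<le> ennreal M * (?R + (?R + ennreal (d / t) * B))"
        using kI by (intro mult_left_mono add_left_mono add_right_mono) (auto intro: add_increasing2)
      also have "\<dots> = ennreal (2 * M) * ?R + ennreal M * (ennreal (d / t) * B)"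
      proof -
        have "ennreal (2 * M) = ennreal M + ennreal M" using M by (simp flip: ennreal_plus)
        then show ?thesis by (simp only: distrib_left distrib_right add_ac)
      qed
      also have "\<dots> \<le> ennreal (2 * M) * ?R + ennreal \<epsilon>"
      proof -
        have "ennreal M * (ennreal (d / t) * B) = ennreal (M * (d / t * \<beta>))"
          using M d t \<beta>
          by (simp add: ennreal_mult del: times_divide_eq_left times_divide_eq_right)
        also have "M * (d / t * \<beta>) = \<epsilon> * (\<beta> / (\<beta> + 1))" using M t by (simp add: d_def)
        also have "\<dots> \<le> \<epsilon> * 1" using \<epsilon> \<beta> by (intro mult_left_mono) auto
        finally have "ennreal M * (ennreal (d / t) * B) \<le> ennreal \<epsilon>"
          by (simp add: ennreal_leI)
        then show ?thesis by (rule add_left_mono)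
      qed
      finally show "K_functional (eta p b0 b1 t) f ?X0 ?X1 \<le> ennreal (2 * M) * ?R + ennreal \<epsilon>" .
    qed
  qed (use M in simp)
qed

theorem theorem3p7:
  fixes A0 A1 :: "'a::real_vector qspace"
    and p :: ennreal
    and b0 b1 :: "real \<Rightarrow> real"
  assumes "compatible_couple A0 A1"
    and "0 < p"
    and "b0 \<in> SV1 p" and "b1 \<in> SV1 p"
    and "mono_on {0<..} (eta p b0 b1)"
    and "p < \<infinity> \<Longrightarrow> K_surjective A0 A1"
  shows "approx_on ((carrier A0 + carrier A1) \<times> {0<..})
    (\<lambda>(f, t). K_functional (eta p b0 b1 t) f
                 (interp_space A0 A1 1 p b0) (interp_space A0 A1 1 p b1))
    (\<lambda>(f, t). I1 A0 A1 p b0 t f + eta p b0 b1 t * J1 A0 A1 p b1 t f)"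
proof -
  have A: "quasi_normed_space A0" "quasi_normed_space A1"
    using assms(1) by (simp_all add: compatible_couple_def)
  show ?thesis
    using Holmstedt_upper[OF A assms(2-4)] Holmstedt_lower[OF A assms(2-5)]
    unfolding approx_on_def lesssim_on_def by fastforce
qed

end
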